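(* Let $A,B,C,D,E$ be the following trees on the vertex set $\{1,2,\dots,7\}$: $A$ has edges $12,23,34,45,56,27$; $B$ has edges $12,23,34,45,56,37$; $C$ has edges $12,23,34,45,26,37$; $D$ has edges $12,23,34,45,36,67$; $E$ has edges $12,23,34,45,26,47$. Then $R(T,W_8)=13$ for each $T\in\{A,B,C\}$, $R(D,W_8)=14$ and $R(E,W_8)=15$.
   Context: All graphs are finite and simple. For graphs $G,H$, the Ramsey number $R(G,H)$ is the smallest integer $N$ such that for every graph $F$ of order $N$, either $F$ contains $G$ as a subgraph or the complement $\overline{F}$ contains $H$ as a subgraph. $W_m$ denotes the wheel of order $m+1$, obtained by joining one vertex (the hub) to every vertex of a cycle $C_m$; thus $W_8$ has 9 vertices. *)

theory Defs
  imports "Graph_Theory.Graph_Theory"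
begin

text \<open>
  Finite simple graphs are rendered as \<^locale>\<open>pair_graph\<close>: finite, loop-free, symmetric
  digraphs whose arcs are pairs of vertices, so that an undirected edge \<open>uv\<close> is the pair
  of arcs \<open>(u, v)\<close>, \<open>(v, u)\<close>.
\<close>

definition graph_of :: "'a set \<Rightarrow> ('a \<times> 'a) set \<Rightarrow> 'a pair_pre_digraph" where
  "graph_of V E = \<lparr> pverts = V, parcs = E \<union> E\<inverse> \<rparr>"

definition complement :: "'a pair_pre_digraph \<Rightarrow> 'a pair_pre_digraph" where
  "complement F = \<lparr> pverts = pverts F,
     parcs = {(u, v). u \<in> pverts F \<and> v \<in> pverts F \<and> u \<noteq> v \<and> (u, v) \<notin> parcs F} \<rparr>"

text \<open>The subgraph need not be induced.\<close>

definition contains_subgraph :: "'a pair_pre_digraph \<Rightarrow> 'b pair_pre_digraph \<Rightarrow> bool" where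
  "contains_subgraph F G \<longleftrightarrow>
     (\<exists>S :: 'a pair_pre_digraph.
        subgraph (with_proj S) (with_proj F) \<and> digraph_iso (with_proj G) (with_proj S))"

text \<open>
  Every finite graph is isomorphic to one with vertices in \<^typ>\<open>nat\<close>, so it suffices to let
  \<open>F\<close> range over the latter. By Ramsey's theorem, such an \<open>N\<close> exists whenever \<open>G\<close> and \<open>H\<close>
  are finite simple graphs; otherwise the value is unspecified.
\<close>

definition ramsey_number :: "'a pair_pre_digraph \<Rightarrow> 'b pair_pre_digraph \<Rightarrow> nat" where
  "ramsey_number G H = (LEAST N. \<forall>F :: nat pair_pre_digraph.
     pair_graph F \<and> card (pverts F) = N \<longrightarrow>
       contains_subgraph F G \<or> contains_subgraph (complement F) H)"

text \<open>The rim is the cycle on \<open>0, \<dots>, m - 1\<close> and the hub is \<open>m\<close>; meaningful for \<open>m \<ge> 3\<close>.\<close>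

definition wheel :: "nat \<Rightarrow> nat pair_pre_digraph" where
  "wheel m = graph_of {0..m} ({(i, (i + 1) mod m) | i. i < m} \<union> {(i, m) | i. i < m})"

definition tree_A :: "nat pair_pre_digraph" where
  "tree_A = graph_of {1..7} {(1,2), (2,3), (3,4), (4,5), (5,6), (2,7)}"

definition tree_B :: "nat pair_pre_digraph" where
  "tree_B = graph_of {1..7} {(1,2), (2,3), (3,4), (4,5), (5,6), (3,7)}"

definition tree_C :: "nat pair_pre_digraph" where
  "tree_C = graph_of {1..7} {(1,2), (2,3), (3,4), (4,5), (2,6), (3,7)}"

definition tree_D :: "nat pair_pre_digraph" where
  "tree_D = graph_of {1..7} {(1,2), (2,3), (3,4), (4,5), (3,6), (6,7)}"

definition tree_E :: "nat pair_pre_digraph" where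
  "tree_E = graph_of {1..7} {(1,2), (2,3), (3,4), (4,5), (2,6), (4,7)}"

end

theory Submission
  imports Defs
begin

text \<open>
  Lower bounds: \<open>2 K\<^sub>6\<close>, the disjoint union of \<open>K\<^sub>6\<close> with two copies of \<open>K\<^sub>4\<close> sharing a vertex, and
  the disjoint union of \<open>K\<^sub>6\<close> with \<open>K\<^bsub>4,4\<^esub>\<close>.

  Upper bounds: write the claimed value as \<open>10 + d\<close>, so \<open>d = 3, 3, 3, 4, 5\<close>. Every graph on
  10 vertices contains \<open>T\<close> or has a \<open>C\<^sub>8\<close> in its complement. Hence in a counterexample on
  \<open>10 + d\<close> vertices every degree is at least \<open>d\<close>: otherwise the at least 10 non-neighbours of a
  vertex of small degree give the rim of a wheel with that vertex as hub. On the other hand, a graph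
  of minimum degree \<open>d\<close> all of whose components have at least 7 vertices contains \<open>T\<close>. So one can
  split off two components of size at most 6 and finds a third one in the at least \<open>d - 2\<close> remaining
  vertices. All three have more than \<open>d \<ge> 3\<close> vertices, so the complement contains \<open>K\<^bsub>4,4,4\<^esub>\<close>,
  hence a wheel.

  The two facts about \<open>T\<close> follow from case distinctions that were found by a computer search and
  are replayed by a verified checker.
\<close>

section \<open>Refutation trees for partially coloured graphs\<close>

text \<open>The offset d is the exact minimum degree that forces \<open>T\<close> into components
  with at least 7 vertices. For A, B and C degree 2 is too little, since a long cycle has no vertex
  of degree 3. For D degree 3 is too little: two K_4 sharing a vertex form a connected graph on 7
  vertices, and a copy of D would have to fall into two parts of 3 vertices when the shared vertex
  is deleted. For E degree 4 is too little: K_{4,4} has classes of size 4, while one colour class of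
  E has five vertices. The extremal graphs for D and E are these obstructions together with a K_6.

  Components with at most 6 vertices cannot be excluded by looking for \<open>T\<close>, which has 7
  vertices; they are the reason why the argument ends by finding a wheel rather than a tree.

  The case distinctions stay short because refuted patterns are reused under any injective renaming,
  which plays the role of "without loss of generality".\<close>

text \<open>
  A pattern lists vertices, edges that must be present (red), and edges that must be absent (blue).
  A certificate shows that a pattern cannot be embedded injectively: either the pattern contains an
  image of one refuted earlier (\<open>Cite\<close>), or one distinguishes the colours of an edge (\<open>Split\<close>), or
  adds a new vertex \<open>w\<close>, which is a red neighbour either of a given vertex \<open>v\<close> of too small known
  degree (\<open>Nbr\<close>) or of some vertex of the pattern, since components are large (\<open>Exit\<close>).
\<close>

type_synonym edges = "(nat \<times> nat) list"
type_synonym pattern = "nat list \<times> edges \<times> edges"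

datatype cert =
    Cite nat "nat list"
  | Split nat nat cert cert
  | Nbr nat nat cert
  | Exit nat "(nat \<times> cert) list"

fun adj :: "edges \<Rightarrow> nat \<Rightarrow> nat \<Rightarrow> bool" where
  "adj [] u v \<longleftrightarrow> False"
| "adj ((a, b) # es) u v \<longleftrightarrow> a = u \<and> b = v \<or> a = v \<and> b = u \<or> adj es u v"

fun rename :: "nat list \<Rightarrow> nat list \<Rightarrow> nat \<Rightarrow> nat" where
  "rename (a # as) (b # bs) x = (if x = a then b else rename as bs x)"
| "rename _ _ x = x"

fun cites :: "pattern \<Rightarrow> pattern \<Rightarrow> nat list \<Rightarrow> bool" where
  "cites (vs, red, blue) (ws, red', blue') ys \<longleftrightarrow>
     length ys = length ws \<and> distinct ys \<and> set ys \<subseteq> set vs \<and>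
     list_all (\<lambda>(u, v). adj red (rename ws ys u) (rename ws ys v)) red' \<and>
     list_all (\<lambda>(u, v). adj blue (rename ws ys u) (rename ws ys v)) blue'"

text \<open>Edges are inspected as well as the vertex list because nothing forces the ends of an
  edge to be listed: giving \<open>w\<close> a new image must not change the truth of an edge
  already recorded.\<close>

fun fresh :: "nat \<Rightarrow> pattern \<Rightarrow> bool" where
  "fresh w (vs, red, blue) \<longleftrightarrow> w \<notin> set vs \<and> list_all (\<lambda>(u, v). u \<noteq> w \<and> v \<noteq> w) (red @ blue)"

fun check :: "nat \<Rightarrow> nat \<Rightarrow> (nat \<times> pattern) list \<Rightarrow> pattern \<Rightarrow> cert \<Rightarrow> bool" where
  "check d m L P (Cite i ys) \<longleftrightarrow>
     (case map_of L i of None \<Rightarrow> False | Some Q \<Rightarrow> cites P Q ys)"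
| "check d m L (vs, red, blue) (Split u v c c') \<longleftrightarrow>
     check d m L (vs, (u, v) # red, blue) c \<and> check d m L (vs, red, (u, v) # blue) c'"
| "check d m L (vs, red, blue) (Nbr v w c) \<longleftrightarrow>
     v \<in> set vs \<and> fresh w (vs, red, blue) \<and>
     length (filter (\<lambda>x. x \<noteq> v \<and> \<not> adj blue v x) vs) < d \<and>
     check d m L (w # vs, (v, w) # red, blue) c"
| "check d m L (vs, red, blue) (Exit w cs) \<longleftrightarrow>
     vs \<noteq> [] \<and> length vs \<le> m \<and> fresh w (vs, red, blue) \<and> set vs \<subseteq> fst ` set cs \<and>
     list_all (\<lambda>(u, c). check d m L (w # vs, (u, w) # red, blue) c) cs"

text \<open>\<open>L\<close> starts with patterns known to be absent and is the stock of lemmas on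
  which \<open>Cite\<close> draws. The target must be the pattern that ends up at its head, that is,
  the one refuted last.\<close>

fun check_all ::
  "nat \<Rightarrow> nat \<Rightarrow> (nat \<times> pattern) list \<Rightarrow> pattern \<Rightarrow> (nat \<times> pattern \<times> cert) list \<Rightarrow> bool" where
  "check_all d m L Q [] \<longleftrightarrow> (case L of [] \<Rightarrow> False | (_, P) # _ \<Rightarrow> P = Q)"
| "check_all d m L Q ((i, P, c) # cs) \<longleftrightarrow> check d m L P c \<and> check_all d m ((i, P) # L) Q cs"

text \<open>For \<open>d = 0\<close> and \<open>m = 0\<close> the last two assumptions are vacuous
  and any finite graph qualifies. For \<open>m = 6\<close> the last one says that every connected
  component has at least 7 vertices.\<close>

locale red_graph =
  fixes V :: "'a set" and R :: "'a \<Rightarrow> 'a \<Rightarrow> bool" and d m :: nat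
  assumes finite_V: "finite V"
    and R_sym: "R u v \<Longrightarrow> R v u"
    and R_irrefl: "\<not> R v v"
    and degree: "v \<in> V \<Longrightarrow> d \<le> card {w \<in> V. R v w}"
    and exit: "\<lbrakk>S \<subseteq> V; S \<noteq> {}; card S \<le> m\<rbrakk> \<Longrightarrow> \<exists>u\<in>S. \<exists>w\<in>V - S. R u w"
begin

fun matches :: "(nat \<Rightarrow> 'a) \<Rightarrow> pattern \<Rightarrow> bool" where
  "matches f (vs, red, blue) \<longleftrightarrow> inj_on f (set vs) \<and> f ` set vs \<subseteq> V \<and>
     (\<forall>(u, v)\<in>set red. R (f u) (f v)) \<and> (\<forall>(u, v)\<in>set blue. \<not> R (f u) (f v))"

definition avoids :: "pattern \<Rightarrow> bool" where
  "avoids P \<longleftrightarrow> (\<nexists>f. matches f P)"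

lemma adj_red: "\<lbrakk>adj es u v; \<forall>(u, v)\<in>set es. R (f u) (f v)\<rbrakk> \<Longrightarrow> R (f u) (f v)"
  by (induction es u v rule: adj.induct) (auto intro: R_sym)

lemma adj_blue: "\<lbrakk>adj es u v; \<forall>(u, v)\<in>set es. \<not> R (f u) (f v)\<rbrakk> \<Longrightarrow> \<not> R (f u) (f v)"
  by (induction es u v rule: adj.induct) (auto intro: R_sym)

lemma rename_image: "length ys = length ws \<Longrightarrow> rename ws ys ` set ws \<subseteq> set ys"
  by (induction ws ys rule: list_induct2') auto

lemma rename_inj: "\<lbrakk>length ys = length ws; distinct ys\<rbrakk> \<Longrightarrow> inj_on (rename ws ys) (set ws)"
proof (induction ws ys rule: list_induct2')
  case (4 x xs y ys)
  have "rename xs ys ` set xs \<subseteq> set ys"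
    using 4 by (intro rename_image) auto
  with 4 show ?case by (fastforce simp: inj_on_def)
qed auto

lemma cites_matches:
  assumes "cites P Q ys" "matches f P"
  shows "\<exists>g. matches g Q"
proof -
  obtain vs red blue where P: "P = (vs, red, blue)" by (cases P)
  obtain ws red' blue' where Q: "Q = (ws, red', blue')" by (cases Q)
  let ?r = "rename ws ys"
  have ys: "length ys = length ws" "distinct ys" "set ys \<subseteq> set vs"
    and red': "\<forall>(u, v)\<in>set red'. adj red (?r u) (?r v)"
    and blue': "\<forall>(u, v)\<in>set blue'. adj blue (?r u) (?r v)"
    using assms(1) by (simp_all add: P Q list_all_iff)
  have f: "inj_on f (set vs)" "f ` set vs \<subseteq> V"
    "\<forall>(u, v)\<in>set red. R (f u) (f v)" "\<forall>(u, v)\<in>set blue. \<not> R (f u) (f v)"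
    using assms(2) by (simp_all add: P)
  have img: "?r ` set ws \<subseteq> set vs"
    using rename_image[OF ys(1)] ys(3) by blast
  have "inj_on (f \<circ> ?r) (set ws)"
    using inj_on_subset[OF f(1) img] by (intro comp_inj_on rename_inj ys)
  moreover have "(f \<circ> ?r) ` set ws \<subseteq> V"
    using img f(2) by auto
  moreover have "\<forall>(u, v)\<in>set red'. R (f (?r u)) (f (?r v))"
    using red' adj_red[OF _ f(3)] by blast
  moreover have "\<forall>(u, v)\<in>set blue'. \<not> R (f (?r u)) (f (?r v))"
    using blue' adj_blue[OF _ f(4)] by blast
  ultimately have "matches (f \<circ> ?r) Q"
    by (simp add: Q)
  then show ?thesis by blast
qed

lemma matches_add:
  assumes "matches f (vs, red, blue)" "fresh w (vs, red, blue)" "u \<in> set vs"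
    and "x \<in> V - f ` set vs" "R (f u) x"
  shows "matches (f(w := x)) (w # vs, (u, w) # red, blue)"
proof -
  have "\<forall>(a, b) \<in> set red \<union> set blue. a \<noteq> w \<and> b \<noteq> w" "w \<notin> set vs"
    using assms(2) by (auto simp: list_all_iff)
  then show ?thesis
    using assms by (auto simp: inj_on_def split_def image_iff)
qed

text \<open>Among the images of pattern vertices, \<open>f v\<close> itself is no neighbour of
  \<open>f v\<close> by irreflexivity, and those joined to \<open>v\<close> in blue are none because
  \<open>f\<close> matches. The filter counts the rest; if no neighbour lay outside the image, the
  degree would be less than \<open>d\<close>.\<close>

lemma new_neighbour:
  assumes f: "matches f (vs, red, blue)" and v: "v \<in> set vs"
    and less: "length (filter (\<lambda>x. x \<noteq> v \<and> \<not> adj blue v x) vs) < d"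
  shows "\<exists>x \<in> V - f ` set vs. R (f v) x"
proof (rule ccontr)
  let ?xs = "filter (\<lambda>x. x \<noteq> v \<and> \<not> adj blue v x) vs"
  assume *: "\<not> ?thesis"
  have "w \<in> f ` set ?xs" if w: "w \<in> V" "R (f v) w" for w
  proof -
    obtain x where x: "x \<in> set vs" "w = f x"
      using * w by blast
    have "x \<noteq> v"
      using w x R_irrefl by blast
    moreover have "\<not> adj blue v x"
      using w x f adj_blue[of blue v x f] by auto
    ultimately show ?thesis
      using x by simp
  qed
  then have "card {w \<in> V. R (f v) w} \<le> card (f ` set ?xs)"
    by (intro card_mono) auto
  also have "\<dots> \<le> length ?xs"
    using card_image_le card_length le_trans by blast
  finally show False
    using less degree[of "f v"] f v by auto
qed

declare matches.simps [simp del]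

lemma check_sound:
  assumes "check d m L P c" "\<forall>(i, Q) \<in> set L. avoids Q"
  shows "\<not> matches f P"
  using assms(1)
proof (induction c arbitrary: P f)
  case (Cite i ys)
  then obtain Q where "(i, Q) \<in> set L" "cites P Q ys"
    by (auto split: option.splits dest: map_of_SomeD)
  then show ?case
    using assms(2) cites_matches unfolding avoids_def by blast
next
  case (Split u v c c')
  obtain vs red blue where P: "P = (vs, red, blue)" by (cases P)
  have "\<not> matches f (vs, (u, v) # red, blue)" "\<not> matches f (vs, red, (u, v) # blue)"
    using Split.IH Split.prems unfolding P check.simps by blast+
  then show ?case by (auto simp: P matches.simps)
next
  case (Nbr v w c)
  obtain vs red blue where P: "P = (vs, red, blue)" by (cases P)
  show ?case
  proof
    assume f: "matches f P"
    then obtain x where "x \<in> V - f ` set vs" "R (f v) x"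
      using new_neighbour Nbr.prems unfolding P check.simps by blast
    then have "matches (f(w := x)) (w # vs, (v, w) # red, blue)"
      using matches_add f Nbr.prems unfolding P check.simps by blast
    then show False
      using Nbr.IH Nbr.prems unfolding P check.simps by blast
  qed
next
  case (Exit w cs)
  obtain vs red blue where P: "P = (vs, red, blue)" by (cases P)
  have vs: "vs \<noteq> []" "length vs \<le> m" "fresh w (vs, red, blue)" "set vs \<subseteq> fst ` set cs"
    and cs: "\<And>u c. (u, c) \<in> set cs \<Longrightarrow> check d m L (w # vs, (u, w) # red, blue) c"
    using Exit.prems by (auto simp: P list_all_iff simp del: fresh.simps)
  show ?case
  proof
    assume f: "matches f P"
    have "card (f ` set vs) \<le> length vs"
      using card_image_le card_length le_trans by blast
    then have "\<exists>u \<in> f ` set vs. \<exists>x \<in> V - f ` set vs. R u x"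
      using f vs by (intro exit) (auto simp: P matches.simps)
    then obtain u x where u: "u \<in> set vs" and x: "x \<in> V - f ` set vs" "R (f u) x"
      by blast
    have "matches (f(w := x)) (w # vs, (u, w) # red, blue)"
      using matches_add f vs(3) u x unfolding P by blast
    moreover obtain c where "(u, c) \<in> set cs"
      using u vs(4) by force
    ultimately show False
      using cs[of u c] Exit.IH[of "(u, c)" c] by simp
  qed
qed

text \<open>The targets used below have no edges. For such a target, \<open>avoids\<close> says that
  \<open>V\<close> has fewer elements than the pattern has vertices, so a successful check
  contradicts the presence of ten vertices, or of a single one.\<close>

lemma check_all_sound:
  assumes "check_all d m L Q cs" "\<forall>(i, P) \<in> set L. avoids P"
  shows "avoids Q"
  using assms
proof (induction cs arbitrary: L)
  case Nil
  then show ?case by (auto split: list.splits)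
next
  case (Cons x cs)
  obtain i P c where x: "x = (i, P, c)" by (cases x)
  have "check d m L P c" and all: "check_all d m ((i, P) # L) Q cs"
    using Cons.prems(1) by (simp_all add: x)
  then have "avoids P"
    using Cons.prems(2) check_sound[of L P c] unfolding avoids_def by blast
  then show ?case
    using Cons.prems(2) by (intro Cons.IH[OF all]) simp
qed

end

section \<open>Subgraph containment and Ramsey numbers\<close>

text \<open>Symmetry of \<open>F\<close> supplies the reverse arcs that \<open>graph_of\<close>
  adds, and the subgraph need not be induced. So isomorphisms of digraphs can be traded for
  injections that preserve the listed edges, the only form used from here on.\<close>

lemma contains_subgraph_graph_of:
  assumes F: "pair_graph F" and E: "E \<subseteq> W \<times> W"
  shows "contains_subgraph F (graph_of W E) \<longleftrightarrow>
    (\<exists>f. inj_on f W \<and> f ` W \<subseteq> pverts F \<and> (\<forall>(u, v)\<in>E. (f u, f v) \<in> parcs F))"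
    (is "?L \<longleftrightarrow> ?R")
proof
  interpret F: pair_graph F by fact
  show ?R if ?L
  proof -
    obtain S h where S: "subgraph (with_proj S) (with_proj F)"
      and h: "pre_digraph.digraph_isomorphism (with_proj (graph_of W E)) h"
      and eq: "with_proj S = app_iso h (with_proj (graph_of W E))"
      using \<open>?L\<close> unfolding contains_subgraph_def digraph_iso_def by blast
    \<comment> \<open>Both sides of \<open>eq\<close> have the projections as tail and head maps,
      hence so does \<open>h\<close>. Being an isomorphism, \<open>h\<close> then acts on an arc as
      its vertex map acts on the two ends.\<close>
    have tail: "iso_tail h = fst" and head: "iso_head h = snd"
      using eq by (auto simp: with_proj_def app_iso_def)
    have "pverts S = iso_verts h ` W" "parcs S = iso_arcs h ` (E \<union> E\<inverse>)"
      using eq by (auto simp: with_proj_def app_iso_def graph_of_def)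
    then have sub: "iso_verts h ` W \<subseteq> pverts F" "iso_arcs h ` E \<subseteq> parcs F"
      using S by (auto simp: subgraph_def)
    have "iso_arcs h (u, v) = (iso_verts h u, iso_verts h v)" if "(u, v) \<in> E" for u v
      using h that
      by (auto simp: pre_digraph.digraph_isomorphism_def graph_of_def tail head prod_eq_iff
        dest!: bspec[of "E \<union> E\<inverse>" _ "(u, v)"])
    then show ?R
      using h sub by (intro exI[of _ "iso_verts h"])
        (force simp: pre_digraph.digraph_isomorphism_def graph_of_def)
  qed
  show ?L if ?R
  proof -
    obtain f where f: "inj_on f W" "f ` W \<subseteq> pverts F" "\<forall>(u, v)\<in>E. (f u, f v) \<in> parcs F"
      using \<open>?R\<close> by blast
    define S where "S = \<lparr>pverts = f ` W, parcs = map_prod f f ` (E \<union> E\<inverse>)\<rparr>"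
    define h where "h = \<lparr>iso_verts = f, iso_arcs = map_prod f f, iso_head = snd, iso_tail = fst\<rparr>"
    have "inj_on (map_prod f f) (W \<times> W)"
      using f(1) by (simp add: map_prod_inj_on)
    then have inj: "inj_on (map_prod f f) (E \<union> E\<inverse>)"
      by (rule inj_on_subset) (use E in auto)
    have wf: "wf_digraph (with_proj (graph_of W E))"
      using E by unfold_locales (auto simp: graph_of_def)
    have "(f v, f u) \<in> parcs F" if "(u, v) \<in> E" for u v
      using f(3) that F.sym_arcs F.graph_symmetric by fastforce
    then have "map_prod f f ` (E \<union> E\<inverse>) \<subseteq> parcs F"
      using f(3) by auto
    then have "subgraph (with_proj S) (with_proj F)"
      using f(2) E F.wf_digraph
      by (auto simp: subgraph_def S_def compatible_def wf_digraph_def)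
    moreover have "pre_digraph.digraph_isomorphism (with_proj (graph_of W E)) h"
      using f(1) inj wf by (auto simp: pre_digraph.digraph_isomorphism_def h_def graph_of_def)
    moreover have "with_proj S = app_iso h (with_proj (graph_of W E))"
      by (simp add: with_proj_def app_iso_def S_def h_def graph_of_def)
    ultimately show ?L
      unfolding contains_subgraph_def digraph_iso_def by blast
  qed
qed

section \<open>Pair graphs, their complements, and a criterion for Ramsey numbers\<close>

lemma pair_graphI:
  assumes "finite (pverts F)" "\<And>u v. (u, v) \<in> parcs F \<Longrightarrow> u \<in> pverts F \<and> u \<noteq> v \<and> (v, u) \<in> parcs F"
  shows "pair_graph F"
proof -
  have "parcs F \<subseteq> pverts F \<times> pverts F"
    using assms(2) by auto
  then have "finite (parcs F)"
    using assms(1) finite_subset by blast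
  moreover have "symmetric (with_proj F)"
    using assms(2) by (auto simp: symmetric_def intro: symI)
  ultimately show ?thesis
    using assms by unfold_locales (auto, blast+)
qed

lemma pair_graph_sym: "\<lbrakk>pair_graph F; (u, v) \<in> parcs F\<rbrakk> \<Longrightarrow> (v, u) \<in> parcs F"
proof -
  assume "pair_graph F" then interpret pair_graph F .
  show "(u, v) \<in> parcs F \<Longrightarrow> (v, u) \<in> parcs F"
    using graph_symmetric by blast
qed

lemma pair_graph_arcD:
  assumes "pair_graph F" "(u, v) \<in> parcs F"
  shows "u \<in> pverts F" "v \<in> pverts F" "u \<noteq> v"
proof -
  interpret pair_graph F by fact
  show "u \<in> pverts F" "v \<in> pverts F" "u \<noteq> v"
    using assms(2) wellformed' no_loops' by auto
qed

lemma pair_graph_finite: "pair_graph F \<Longrightarrow> finite (pverts F)"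
  by (simp add: pair_graph_def pair_digraph_def pair_fin_digraph_def pair_fin_digraph_axioms_def)

lemma pair_graph_complement: "pair_graph F \<Longrightarrow> pair_graph (complement F)"
  by (rule pair_graphI) (auto simp: complement_def pair_graph_finite dest: pair_graph_sym)

text \<open>The definition takes the least order that works, so a single bad graph of order
  \<open>n\<close> does not suffice by itself: every \<open>k \<le> n\<close> must fail. The induced
  subgraphs of \<open>F\<close> on \<open>k\<close> vertices are bad too, because containment in
  them, or in their complements, carries over to \<open>F\<close>.\<close>

lemma ramsey_number_eqI:
  fixes F :: "nat pair_pre_digraph"
  assumes E: "E \<subseteq> W \<times> W" "E' \<subseteq> W' \<times> W'"
    and upper: "\<And>F :: nat pair_pre_digraph. \<lbrakk>pair_graph F; card (pverts F) = Suc n\<rbrakk> \<Longrightarrow>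
      contains_subgraph F (graph_of W E) \<or> contains_subgraph (complement F) (graph_of W' E')"
    and F: "pair_graph F" "card (pverts F) = n" "\<not> contains_subgraph F (graph_of W E)"
      "\<not> contains_subgraph (complement F) (graph_of W' E')"
  shows "ramsey_number (graph_of W E) (graph_of W' E') = Suc n"
  unfolding ramsey_number_def
proof (rule Least_equality)
  fix k
  assume k: "\<forall>F :: nat pair_pre_digraph. pair_graph F \<and> card (pverts F) = k \<longrightarrow>
    contains_subgraph F (graph_of W E) \<or> contains_subgraph (complement F) (graph_of W' E')"
  show "Suc n \<le> k"
  proof (rule ccontr)
    assume "\<not> Suc n \<le> k"
    then obtain X where X: "X \<subseteq> pverts F" "card X = k"
      using F(2) by (metis not_less_eq_eq obtain_subset_with_card_n)
    define F' where "F' = \<lparr>pverts = X, parcs = parcs F \<inter> X \<times> X\<rparr>"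
    have F': "pair_graph F'"
      using X(1) finite_subset[OF X(1)] pair_graph_finite[OF F(1)]
      by (intro pair_graphI) (auto simp: F'_def dest: pair_graph_sym[OF F(1)] pair_graph_arcD[OF F(1)])
    have "contains_subgraph F (graph_of W E)" if "contains_subgraph F' (graph_of W E)"
      using that X(1) unfolding contains_subgraph_graph_of[OF F' E(1)]
        contains_subgraph_graph_of[OF F(1) E(1)]
      by (fastforce simp: F'_def)
    moreover have "contains_subgraph (complement F) (graph_of W' E')"
      if "contains_subgraph (complement F') (graph_of W' E')"
      using that X(1) unfolding contains_subgraph_graph_of[OF pair_graph_complement[OF F'] E(2)]
        contains_subgraph_graph_of[OF pair_graph_complement[OF F(1)] E(2)]
      by (fastforce simp: F'_def complement_def)
    moreover have "card (pverts F') = k"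
      using X(2) by (simp add: F'_def)
    ultimately show False
      using k F' F(3,4) by blast
  qed
qed (use upper in blast)

section \<open>The structure of a counterexample\<close>

abbreviation tree_pattern :: "edges \<Rightarrow> pattern" where
  "tree_pattern es \<equiv> ([1,2,3,4,5,6,7], es, [])"

abbreviation cycle_pattern :: pattern where
  "cycle_pattern \<equiv> ([0,1,2,3,4,5,6,7], [], [(0,1),(1,2),(2,3),(3,4),(4,5),(5,6),(6,7),(7,0)])"

lemma wheel_subset: "{(i, (i + 1) mod m) | i. i < m} \<union> {(i, m) | i. i < m} \<subseteq> {0..m} \<times> {0..m :: nat}"
proof -
  have "(i + 1) mod m \<le> m" if "i < m" for i
    using that mod_less_divisor[of m "i + 1"] by linarith
  then show ?thesis by fastforce
qed

lemma contains_wheel8: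
  fixes f :: "nat \<Rightarrow> 'a"
  assumes F: "pair_graph F" and f: "inj_on f {..<8}" "f ` {..<8} \<subseteq> pverts F - {h}" "h \<in> pverts F"
    and rim: "\<forall>i<8. (f i, f ((i + 1) mod 8)) \<in> parcs F" and spoke: "\<forall>i<8. (f i, h) \<in> parcs F"
  shows "contains_subgraph F (wheel 8)"
proof -
  have "{0..8} = insert 8 {..<8::nat}"
    by auto
  then have "inj_on (f(8 := h)) {0..8}" "(f(8 := h)) ` {0..8} \<subseteq> pverts F"
    using f by (auto simp: inj_on_def)
  moreover have "((f(8 := h)) u, (f(8 := h)) v) \<in> parcs F"
    if uv: "(u, v) \<in> {(i, (i + 1) mod 8) | i. i < 8} \<union> {(i, 8) | i. i < 8}" for u v
  proof -
    consider "u < 8" "v = (u + 1) mod 8" | "u < 8" "v = 8"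
      using uv by blast
    then show ?thesis
    proof cases
      case 1
      then have "v < 8" "(f u, f v) \<in> parcs F" using rim by auto
      then show ?thesis using 1(1) by simp
    qed (use spoke in simp)
  qed
  ultimately show ?thesis
    unfolding wheel_def contains_subgraph_graph_of[OF F wheel_subset] by blast
qed

text \<open>Such a set is a union of connected components. Connectedness is not demanded: what
  matters later is that disjoint closed sets are completely joined in the complement.\<close>

definition arc_closed :: "'a pair_pre_digraph \<Rightarrow> 'a set \<Rightarrow> bool" where
  "arc_closed F S \<longleftrightarrow> S \<subseteq> pverts F \<and> (\<forall>u\<in>S. \<forall>w\<in>pverts F - S. (u, w) \<notin> parcs F)"

locale counterexample =
  fixes F :: "'a pair_pre_digraph" and es :: edges and d :: nat
  assumes F: "pair_graph F" and card_F: "card (pverts F) = 10 + d"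
    and es: "set es \<subseteq> {1..7} \<times> {1..7}"
    and no_tree: "\<not> contains_subgraph F (graph_of {1..7} (set es))"
    and no_wheel: "\<not> contains_subgraph (complement F) (wheel 8)"
begin

text \<open>The set \<open>U\<close> is left open for two uses: the non-neighbours of a vertex, and
  a closed set of vertices.\<close>

lemma avoids_tree:
  assumes "red_graph U (\<lambda>u v. (u, v) \<in> parcs F) d' m" "U \<subseteq> pverts F"
  shows "red_graph.avoids U (\<lambda>u v. (u, v) \<in> parcs F) (tree_pattern es)"
proof -
  interpret red_graph U "\<lambda>u v. (u, v) \<in> parcs F" d' m by fact
  have set: "set [1,2,3,4,5,6,7] = {1..7::nat}"
    by auto
  have "contains_subgraph F (graph_of {1..7} (set es))" if "matches f (tree_pattern es)" for f
  proof -
    have "inj_on f {1..7}" "f ` {1..7} \<subseteq> U" "\<forall>(u, v)\<in>set es. (f u, f v) \<in> parcs F"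
      using that unfolding matches.simps set by simp_all
    then show ?thesis
      using assms(2) unfolding contains_subgraph_graph_of[OF F es] by blast
  qed
  then show ?thesis
    using no_tree unfolding avoids_def by blast
qed

lemma min_degree:
  assumes check: "check_all 0 0 [(0, tree_pattern es), (1, cycle_pattern)] ([0,1,2,3,4,5,6,7,8,9], [], []) cs"
    and v: "v \<in> pverts F"
  shows "d \<le> card {w \<in> pverts F. (v, w) \<in> parcs F}"
proof (rule ccontr)
  let ?R = "\<lambda>u v. (u, v) \<in> parcs F"
  assume less: "\<not> ?thesis"
  define U where "U = pverts F - {v} - {w \<in> pverts F. ?R v w}"
  have fin: "finite (pverts F)"
    using F by (rule pair_graph_finite)
  \<comment> \<open>If the degree of \<open>v\<close> is at most \<open>d - 1\<close>, there remain
    at least \<open>10 + d - 1 - (d - 1) = 10\<close> non-neighbours.\<close>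
  have "card U \<ge> card (pverts F - {v}) - card {w \<in> pverts F. ?R v w}"
    unfolding U_def by (intro diff_card_le_card_Diff) (use fin in auto)
  then have card_U: "10 \<le> card U"
    using less card_F v fin by simp
  have "finite U"
    using fin by (simp add: U_def)
  moreover have "(u, u) \<notin> parcs F" for u
    using pair_graph_arcD(3)[OF F] by blast
  \<comment> \<open>Nothing is known about degrees or components inside \<open>U\<close>, hence the
    vacuous parameters 0 and 0.\<close>
  ultimately interpret red_graph U ?R 0 0
    by (intro red_graph.intro) (auto dest: finite_subset intro: pair_graph_sym[OF F])
  obtain X where "X \<subseteq> U" "card X = 10"
    using obtain_subset_with_card_n[OF card_U] by blast
  moreover from this obtain f where "bij_betw f {0..<10::nat} X"
    using ex_bij_betw_nat_finite[of X] finite_subset[OF _ finite_V] by auto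
  moreover have "set [0,1,2,3,4,5,6,7,8,9] = {0..<10::nat}"
    by auto
  ultimately have "matches f ([0,1,2,3,4,5,6,7,8,9], [], [])"
    unfolding matches.simps by (simp add: bij_betw_def)
  then have "\<not> avoids ([0,1,2,3,4,5,6,7,8,9], [], [])"
    unfolding avoids_def by blast
  moreover have "avoids (tree_pattern es)"
    by (rule avoids_tree[OF red_graph_axioms]) (auto simp: U_def)
  \<comment> \<open>The check would refute ten vertices if both starting patterns were absent. Ten
    vertices exist and the tree is absent, so the blue 8-cycle must be present.\<close>
  ultimately obtain g where g: "matches g cycle_pattern"
    using check_all_sound[OF check] unfolding avoids_def by auto
  have rim: "set [0,1,2,3,4,5,6,7] = {..<8::nat}"
    by auto
  have g: "inj_on g {..<8}" "g ` {..<8} \<subseteq> U"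
      "\<forall>(i, j) \<in> set [(0,1),(1,2),(2,3),(3,4),(4,5),(5,6),(6,7),(7,0)]. (g i, g j) \<notin> parcs F"
    using g unfolding matches.simps rim by simp_all
  have nonadj: "(g i, g ((i + 1) mod 8)) \<notin> parcs F" if "i < 8" for i
  proof -
    have "(i, (i + 1) mod 8) \<in> set [(0,1),(1,2),(2,3),(3,4),(4,5),(5,6),(6,7),(7,0)]"
    proof -
      have "i = 0 \<or> i = 1 \<or> i = 2 \<or> i = 3 \<or> i = 4 \<or> i = 5 \<or> i = 6 \<or> i = 7"
        using that by linarith
      then show ?thesis by (elim disjE) simp_all
    qed
    then show ?thesis using g(3) by blast
  qed
  \<comment> \<open>Blue means only "not an arc of \<open>F\<close>", which also holds for a vertex
    and itself, whereas arcs of the complement need distinct ends.\<close>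
  have neq: "g i \<noteq> g ((i + 1) mod 8)" if "i < 8" for i
  proof -
    have "(i + 1) mod 8 \<noteq> i" "(i + 1) mod 8 < 8"
      using that by presburger+
    then show ?thesis
      using inj_onD[OF g(1), of i "(i + 1) mod 8"] that by auto
  qed
  have U: "g i \<in> pverts F" "g i \<noteq> v" "(g i, v) \<notin> parcs F" if "i < 8" for i
    using g(2) that pair_graph_sym[OF F, of "g i" v] unfolding U_def by blast+
  have rim: "\<forall>i<8. (g i, g ((i + 1) mod 8)) \<in> parcs (complement F)"
    using U nonadj neq by (simp add: complement_def)
  have spoke: "\<forall>i<8. (g i, v) \<in> parcs (complement F)"
    using U v by (simp add: complement_def)
  have "g ` {..<8} \<subseteq> pverts (complement F) - {v}" "v \<in> pverts (complement F)"
    using U v by (auto simp: complement_def)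
  then have "contains_subgraph (complement F) (wheel 8)"
    by (rule contains_wheel8[OF pair_graph_complement[OF F] g(1) _ _ rim spoke])
  with no_wheel show False ..
qed

text \<open>If every nonempty closed subset of \<open>U\<close> had at least 7 vertices,
  \<open>U\<close> would satisfy the assumptions of \<open>red_graph\<close> with
  \<open>m = 6\<close>: since \<open>U\<close> is closed, arcs leaving a subset of \<open>U\<close>
  stay in \<open>U\<close>, and no vertex loses neighbours on passing to \<open>U\<close>. The check
  would then refute a single vertex, so \<open>U\<close> would be empty.\<close>

lemma small_closed:
  assumes check: "check_all d 6 [(0, tree_pattern es)] ([0], [], []) cs"
    and degree: "\<And>v. v \<in> pverts F \<Longrightarrow> d \<le> card {w \<in> pverts F. (v, w) \<in> parcs F}"
    and U: "arc_closed F U" "U \<noteq> {}"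
  shows "\<exists>S\<subseteq>U. arc_closed F S \<and> d < card S \<and> card S \<le> 6"
proof -
  let ?R = "\<lambda>u v. (u, v) \<in> parcs F"
  have fin: "finite (pverts F)"
    using F by (rule pair_graph_finite)
  have "\<exists>S\<subseteq>U. S \<noteq> {} \<and> card S \<le> 6 \<and> arc_closed F S"
  proof (rule ccontr)
    assume *: "\<not> ?thesis"
    have "\<exists>u\<in>S. \<exists>w\<in>U - S. ?R u w" if "S \<subseteq> U" "S \<noteq> {}" "card S \<le> 6" for S
    proof -
      have "\<not> arc_closed F S" using * that by blast
      then show ?thesis using that(1) U(1) unfolding arc_closed_def by blast
    qed
    moreover have "d \<le> card {w \<in> U. ?R v w}" if "v \<in> U" for v
    proof -
      have "{w \<in> pverts F. ?R v w} = {w \<in> U. ?R v w}"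
        using that U(1) unfolding arc_closed_def by blast
      then show ?thesis
        using degree[of v] that U(1) unfolding arc_closed_def by auto
    qed
    moreover have "finite U"
      using U(1) fin finite_subset unfolding arc_closed_def by auto
    moreover have "(v, v) \<notin> parcs F" for v
      using pair_graph_arcD(3)[OF F] by blast
    ultimately interpret red_graph U ?R d 6
      using pair_graph_sym[OF F] by (intro red_graph.intro) blast+
    have "avoids ([0], [], [])"
      using check_all_sound[OF check] avoids_tree[OF red_graph_axioms] U(1) by (simp add: arc_closed_def)
    moreover obtain u where "u \<in> U" using U(2) by blast
    then have "matches (\<lambda>_. u) ([0], [], [])"
      by (simp add: matches.simps)
    ultimately show False
      by (auto simp: avoids_def)
  qed
  then obtain S where S: "S \<subseteq> U" "S \<noteq> {}" "card S \<le> 6" "arc_closed F S"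
    by blast
  then obtain v where v: "v \<in> S" by blast
  \<comment> \<open>A closed set contains, along with \<open>v\<close>, the at least
    \<open>d\<close> neighbours of \<open>v\<close>, which gives the strict lower bound on its
    size.\<close>
  have "{w \<in> pverts F. ?R v w} \<subseteq> S - {v}"
    using S(4) v pair_graph_arcD(3)[OF F] unfolding arc_closed_def by blast
  moreover have "finite S"
    using S(4) fin finite_subset unfolding arc_closed_def by blast
  ultimately have "card {w \<in> pverts F. ?R v w} < card S"
    using v by (metis card_Diff1_less card_mono finite_Diff le_less_trans)
  then have "d < card S"
    using degree[of v] v S(4) unfolding arc_closed_def by fastforce
  then show ?thesis using S by blast
qed

lemma closed_diff: "\<lbrakk>arc_closed F U; arc_closed F S\<rbrakk> \<Longrightarrow> arc_closed F (U - S)"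
  unfolding arc_closed_def using pair_graph_sym[OF F] by blast

lemma peel_closed:
  assumes "check_all d 6 [(0, tree_pattern es)] ([0], [], []) cs"
    and "check_all 0 0 [(0, tree_pattern es), (1, cycle_pattern)] ([0,1,2,3,4,5,6,7,8,9], [], []) cs'"
    and "arc_closed F U" "U \<noteq> {}"
  obtains S where "S \<subseteq> U" "arc_closed F S" "d < card S" "card S \<le> 6"
    "arc_closed F (U - S)" "card (U - S) = card U - card S"
proof -
  obtain S where S: "S \<subseteq> U" "arc_closed F S" "d < card S" "card S \<le> 6"
    using small_closed[OF assms(1) min_degree[OF assms(2)] assms(3,4)] by blast
  moreover have "finite S"
    using S(3) card.infinite by fastforce
  ultimately show thesis
    using that closed_diff[OF assms(3)] card_Diff_subset by blast
qed

lemma three_closed: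
  assumes "check_all d 6 [(0, tree_pattern es)] ([0], [], []) cs"
    and "check_all 0 0 [(0, tree_pattern es), (1, cycle_pattern)] ([0,1,2,3,4,5,6,7,8,9], [], []) cs'"
    and d: "d \<ge> 3"
  obtains S1 S2 S3 where "arc_closed F S1" "arc_closed F S2" "arc_closed F S3"
    "S1 \<inter> S2 = {}" "S1 \<inter> S3 = {}" "S2 \<inter> S3 = {}"
    "d < card S1" "d < card S2" "d < card S3"
proof -
  note peel = peel_closed[OF assms(1,2)]
  have "arc_closed F (pverts F)"
    by (simp add: arc_closed_def)
  moreover have "pverts F \<noteq> {}"
    using card_F by auto
  ultimately obtain S1 where S1: "S1 \<subseteq> pverts F" "arc_closed F S1" "d < card S1" "card S1 \<le> 6"
    "arc_closed F (pverts F - S1)" "card (pverts F - S1) = 10 + d - card S1"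
    using peel card_F by metis
  have "pverts F - S1 \<noteq> {}"
    using S1(4,6) by (intro notI) simp
  then obtain S2 where S2: "S2 \<subseteq> pverts F - S1" "arc_closed F S2" "d < card S2" "card S2 \<le> 6"
    "arc_closed F (pverts F - S1 - S2)" "card (pverts F - S1 - S2) = 10 + d - card S1 - card S2"
    using peel[OF S1(5)] S1(6) by metis
  \<comment> \<open>At least \<open>10 + d - 6 - 6 = d - 2\<close> vertices are left, a positive
    number because \<open>d \<ge> 3\<close>.\<close>
  have "pverts F - S1 - S2 \<noteq> {}"
    using S1(4) S2(4,6) d by (intro notI) simp
  then obtain S3 where S3: "S3 \<subseteq> pverts F - S1 - S2" "arc_closed F S3" "d < card S3"
    using peel[OF S2(5)] by metis
  then show thesis
    using that[of S1 S2 S3] S1 S2 by blast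
qed

text \<open>\<open>W_8\<close> lies in \<open>K_{1,4,4}\<close>: the hub comes from
  \<open>S1\<close>, and the rim alternates between four vertices of \<open>S2\<close> and four of
  \<open>S3\<close>, which closes up because 8 is even. The bound \<open>d \<ge> 3\<close> enters a
  second time here, to make these sets large enough.\<close>

lemma no_counterexample:
  assumes "check_all d 6 [(0, tree_pattern es)] ([0], [], []) cs"
    and "check_all 0 0 [(0, tree_pattern es), (1, cycle_pattern)] ([0,1,2,3,4,5,6,7,8,9], [], []) cs'"
    and d: "d \<ge> 3"
  shows False
proof -
  obtain S1 S2 S3 where S: "arc_closed F S1" "arc_closed F S2" "arc_closed F S3"
    "S1 \<inter> S2 = {}" "S1 \<inter> S3 = {}" "S2 \<inter> S3 = {}"
    "d < card S1" "d < card S2" "d < card S3"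
    using three_closed[OF assms] by blast
  have sub: "S1 \<subseteq> pverts F" "S2 \<subseteq> pverts F" "S3 \<subseteq> pverts F"
    using S(1-3) by (auto simp: arc_closed_def)
  have fin: "finite S1" "finite S2" "finite S3"
    using sub pair_graph_finite[OF F] finite_subset by blast+
  have "\<exists>a :: nat \<Rightarrow> 'a. inj_on a {..<4} \<and> a ` {..<4} \<subseteq> T" if "finite T" "4 \<le> card T" for T
    using card_le_inj[of "{..<4::nat}" T] that by auto
  moreover have four: "4 \<le> card S2" "4 \<le> card S3"
    using S(8,9) d by linarith+
  ultimately obtain a b :: "nat \<Rightarrow> 'a" where a: "inj_on a {..<4}" "a ` {..<4} \<subseteq> S2"
    and b: "inj_on b {..<4}" "b ` {..<4} \<subseteq> S3"
    using fin by metis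
  obtain h where h: "h \<in> S1"
    using S(7) by fastforce
  define f where "f i = (if even i then a (i div 2) else b (i div 2))" for i
  have f: "f i \<in> (if even i then S2 else S3)" if "i < 8" for i
    using that a(2) b(2) by (auto simp: f_def)
  have f': "f i \<in> S2 \<union> S3" if "i < 8" for i
    using f[OF that] by (cases "even i") auto
  have cross: "(u, v) \<in> parcs (complement F)"
    if "u \<in> S" "v \<in> S'" "arc_closed F S" "arc_closed F S'" "S \<inter> S' = {}" for u v S S'
  proof -
    have *: "u \<in> pverts F" "v \<in> pverts F - S" "u \<noteq> v"
      using that unfolding arc_closed_def by blast+
    then have "(u, v) \<notin> parcs F"
      using that(1,3) unfolding arc_closed_def by blast
    with * show ?thesis by (simp add: complement_def)
  qed
  have "inj_on f {..<8}"
  proof (rule inj_onI)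
    fix i j :: nat
    assume ij: "i \<in> {..<8}" "j \<in> {..<8}" "f i = f j"
    have "even i = even j"
      using f[of i] f[of j] ij S(6) by (cases "even i"; cases "even j") auto
    moreover from this have "i div 2 = j div 2"
      using ij inj_onD[OF a(1), of "i div 2" "j div 2"] inj_onD[OF b(1), of "i div 2" "j div 2"]
      by (auto simp: f_def split: if_splits)
    ultimately show "i = j"
      by (metis even_iff_mod_2_eq_zero mult_div_mod_eq odd_iff_mod_2_eq_one)
  qed
  moreover have "f ` {..<8} \<subseteq> pverts (complement F) - {h}" "h \<in> pverts (complement F)"
  proof -
    have "f i \<in> pverts F - {h}" if "i < 8" for i
      using f'[OF that] sub h S(4,5) by blast
    then show "f ` {..<8} \<subseteq> pverts (complement F) - {h}"
      by (auto simp: complement_def)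
    show "h \<in> pverts (complement F)"
      using h sub(1) by (auto simp: complement_def)
  qed
  moreover have "\<forall>i<8. (f i, f ((i + 1) mod 8)) \<in> parcs (complement F)"
  proof (intro allI impI)
    fix i :: nat
    assume i: "i < 8"
    have "even ((i + 1) mod 8) \<longleftrightarrow> odd i" "(i + 1) mod 8 < 8"
      by presburger+
    then have "f ((i + 1) mod 8) \<in> (if even i then S3 else S2)"
      using f[of "(i + 1) mod 8"] by presburger
    then show "(f i, f ((i + 1) mod 8)) \<in> parcs (complement F)"
      using f[OF i] cross[of _ S2 _ S3] cross[of _ S3 _ S2] S(2,3,6)
      by (cases "even i") (auto simp: Int_commute)
  qed
  moreover have "\<forall>i<8. (f i, h) \<in> parcs (complement F)"
    using f' cross[OF _ h _ S(1)] S(2-5) by blast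
  ultimately show False
    using contains_wheel8[OF pair_graph_complement[OF F]] no_wheel by blast
qed

end

section \<open>Lower bounds\<close>

text \<open>The diagonal is removed here, so that \<open>r\<close> may be true on it; unions of
  cliques then have simple formulas.\<close>

definition graph_on :: "nat \<Rightarrow> (nat \<Rightarrow> nat \<Rightarrow> bool) \<Rightarrow> nat pair_pre_digraph" where
  "graph_on n r = \<lparr>pverts = {..<n}, parcs = {(u, v). u < n \<and> v < n \<and> u \<noteq> v \<and> r u v}\<rparr>"

lemma pair_graph_on: "symp r \<Longrightarrow> pair_graph (graph_on n r)"
  by (rule pair_graphI) (auto simp: graph_on_def dest: sympD)

lemma card_graph_on: "card (pverts (graph_on n r)) = n"
  by (simp add: graph_on_def)

lemma graph_on_containsE:
  assumes "contains_subgraph (graph_on n r) (graph_of W E)" "E \<subseteq> W \<times> W"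
    and sym: "symp r"
  obtains f where "inj_on f W" "f ` W \<subseteq> {..<n}" "\<And>u v. (u, v) \<in> E \<Longrightarrow> r (f u) (f v)"
proof -
  obtain f where f: "inj_on f W" "f ` W \<subseteq> {..<n}"
    and "\<forall>(u, v) \<in> E. (f u, f v) \<in> parcs (graph_on n r)"
    using assms(1) unfolding contains_subgraph_graph_of[OF pair_graph_on[OF sym] assms(2)]
    by (auto simp: graph_on_def)
  then have "r (f u) (f v)" if "(u, v) \<in> E" for u v
    using that by (auto simp: graph_on_def)
  with f show thesis using that by blast
qed

lemma complement_graph_on_wheel8E:
  assumes "contains_subgraph (complement (graph_on n r)) (wheel 8)"
    and sym: "symp r"
  obtains f :: "nat \<Rightarrow> nat" and h where "inj_on f {..<8}" "\<And>i. i < 8 \<Longrightarrow> f i < n \<and> f i \<noteq> h" "h < n"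
    "\<And>i. i < 8 \<Longrightarrow> \<not> r (f i) (f ((i + 1) mod 8))" "\<And>i. i < 8 \<Longrightarrow> \<not> r (f i) h"
proof -
  let ?E = "{(i, (i + 1) mod 8) | i. i < 8} \<union> {(i, 8) | i. i < (8 :: nat)}"
  obtain f :: "nat \<Rightarrow> nat" where f: "inj_on f {0..8}" "f ` {0..8} \<subseteq> {..<n}"
    and arc: "\<forall>(u, v) \<in> ?E. (f u, f v) \<in> parcs (complement (graph_on n r))"
    using assms(1)
    unfolding wheel_def contains_subgraph_graph_of[OF pair_graph_complement[OF pair_graph_on[OF sym]] wheel_subset]
    by (auto simp: complement_def graph_on_def)
  have "(i, (i + 1) mod 8) \<in> ?E" "(i, 8) \<in> ?E" if "i < 8" for i
    using that by blast+
  then have arc: "\<not> r (f i) (f ((i + 1) mod 8))" "\<not> r (f i) (f 8)" "f i \<noteq> f 8" if "i < 8" for i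
    using arc that unfolding complement_def graph_on_def by fastforce+
  have "f i < n" if "i \<le> 8" for i
    using f(2) that by (auto simp: image_subset_iff)
  moreover have "inj_on f {..<8}"
    using f(1) by (rule inj_on_subset) auto
  ultimately show thesis
    using arc that[of f "f 8"] by simp
qed

lemma inj_card_contradiction:
  assumes "inj_on f A" "f ` A \<subseteq> B" "finite B" "card B < card A"
  shows False
  using card_inj_on_le[OF assms(1-3)] assms(4) by simp

text \<open>A vertex cover of \<open>C_8\<close> has at least four vertices, one from each of the
  disjoint rim edges joining positions \<open>2 * i\<close> and \<open>2 * i + 1\<close>;
  \<open>g\<close> selects them.\<close>

lemma rim_card:
  fixes f :: "nat \<Rightarrow> 'a"
  assumes "inj_on f {..<8}" "\<And>i. i < 8 \<Longrightarrow> f i \<in> S \<or> f ((i + 1) mod 8) \<in> S" "finite S"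
  shows "4 \<le> card S"
proof -
  define g where "g i = (if f (2 * i) \<in> S then f (2 * i) else f (2 * i + 1))" for i
  have "inj_on g {..<4}"
  proof (rule inj_onI)
    fix i j :: nat
    assume ij: "i \<in> {..<4}" "j \<in> {..<4}" "g i = g j"
    obtain a b where ab: "a = 2 * i \<or> a = 2 * i + 1" "b = 2 * j \<or> b = 2 * j + 1" "f a = f b"
      using ij(3) unfolding g_def by metis
    then have "a = b"
      using ij(1,2) by (intro inj_onD[OF assms(1)]) auto
    then show "i = j" using ab(1,2) by presburger
  qed
  moreover have "g ` {..<4} \<subseteq> S"
    using assms(2)[of "2 * i" for i] by (auto simp: g_def)
  ultimately show ?thesis
    using card_inj_on_le[OF _ _ assms(3), of g "{..<4}"] by simp
qed

section \<open>Two disjoint copies of K_6 against the trees A, B and C\<close>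

definition two_K6 :: "nat \<Rightarrow> nat \<Rightarrow> bool" where
  "two_K6 u v \<longleftrightarrow> (u < 6 \<longleftrightarrow> v < 6)"

lemma symp_two_K6: "symp two_K6"
  by (auto simp: symp_def two_K6_def)

text \<open>The complement is the bipartite graph \<open>K_{6,6}\<close>, but the hub and two
  consecutive rim vertices form a triangle.\<close>

lemma two_K6_no_wheel: "\<not> contains_subgraph (complement (graph_on 12 two_K6)) (wheel 8)"
proof
  assume "contains_subgraph (complement (graph_on 12 two_K6)) (wheel 8)"
  then obtain f :: "nat \<Rightarrow> nat" and h where "\<And>i. i < 8 \<Longrightarrow> \<not> two_K6 (f i) (f ((i + 1) mod 8))"
    "\<And>i. i < 8 \<Longrightarrow> \<not> two_K6 (f i) h"
    by (rule complement_graph_on_wheel8E[OF _ symp_two_K6]) blast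
  from this(1)[of 0] this(2)[of 0] this(2)[of 1] show False
    by (auto simp: two_K6_def)
qed

text \<open>A connected graph on 7 vertices would have to lie in one K_6. Connectedness is expressed
  by \<open>conn\<close>: a predicate that agrees at the ends of each edge is constant.\<close>

lemma two_K6_no_tree:
  assumes "E \<subseteq> {1..7} \<times> {1..7}"
    and conn: "\<And>P :: nat \<Rightarrow> bool. \<forall>(u, v) \<in> E. P u = P v \<Longrightarrow> \<forall>i\<in>{1..7}. P i = P 1"
  shows "\<not> contains_subgraph (graph_on 12 two_K6) (graph_of {1..7} E)"
proof
  assume "contains_subgraph (graph_on 12 two_K6) (graph_of {1..7} E)"
  then obtain f where f: "inj_on f {1..7}" "f ` {1..7} \<subseteq> {..<12}"
    "\<And>u v. (u, v) \<in> E \<Longrightarrow> two_K6 (f u) (f v)"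
    by (rule graph_on_containsE[OF _ assms(1) symp_two_K6]) blast
  have "\<forall>i\<in>{1..7}. (f i < 6) = (f 1 < 6)"
    using f(3) by (intro conn) (auto simp: two_K6_def)
  then have "(\<forall>i\<in>{1..7}. f i < 6) \<or> (\<forall>i\<in>{1..7}. 6 \<le> f i)"
    by (metis not_less)
  then have "f ` {1..7} \<subseteq> {..<6} \<or> f ` {1..7} \<subseteq> {6..<12}"
    using f(2) unfolding image_subset_iff by force
  then show False
    using f(1) inj_card_contradiction[of f "{1..7}" "{..<6}"]
      inj_card_contradiction[of f "{1..7}" "{6..<12}"] by auto
qed

section \<open>K_6 together with two copies of K_4 sharing a vertex, against the tree D\<close>

definition K6_bowtie :: "nat \<Rightarrow> nat \<Rightarrow> bool" where
  "K6_bowtie u v \<longleftrightarrow> u < 6 \<and> v < 6 \<or>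
     6 \<le> u \<and> 6 \<le> v \<and> (u = 6 \<or> v = 6 \<or> (u < 10 \<longleftrightarrow> v < 10))"

lemma symp_K6_bowtie: "symp K6_bowtie"
  by (auto simp: symp_def K6_bowtie_def)

text \<open>The two K_4 are on 6, 7, 8, 9 and on 6, 10, 11, 12. A hub in the K_6 leaves only seven
  candidates for the rim. For any other hub, the rim lies in the K_6 and at most three further
  vertices, namely the part of the other K_4 without 6.\<close>

lemma K6_bowtie_no_wheel: "\<not> contains_subgraph (complement (graph_on 13 K6_bowtie)) (wheel 8)"
proof
  assume "contains_subgraph (complement (graph_on 13 K6_bowtie)) (wheel 8)"
  then obtain f :: "nat \<Rightarrow> nat" and h where f: "inj_on f {..<8}" "\<And>i. i < 8 \<Longrightarrow> f i < 13 \<and> f i \<noteq> h" "h < 13"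
    and rim: "\<And>i. i < 8 \<Longrightarrow> \<not> K6_bowtie (f i) (f ((i + 1) mod 8))"
    and spoke: "\<And>i. i < 8 \<Longrightarrow> \<not> K6_bowtie (f i) h"
    by (rule complement_graph_on_wheel8E[OF _ symp_K6_bowtie]) blast
  have mod: "(i + 1) mod 8 < 8" for i :: nat by simp
  \<comment> \<open>The vertices of the K_6 are pairwise non-adjacent in the complement, so
    \<open>S\<close> must cover all rim edges, which takes four vertices.\<close>
  have False if sub: "\<And>i. i < 8 \<Longrightarrow> f i < 6 \<or> f i \<in> S" "finite S" "card S < 4" for S
  proof -
    have "f i \<in> S \<or> f ((i + 1) mod 8) \<in> S" if "i < 8" for i
      using sub(1)[OF that] sub(1)[OF mod] rim[OF that] by (auto simp: K6_bowtie_def)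
    from rim_card[OF f(1) this sub(2)] show False
      using sub(3) by simp
  qed note small = this
  consider "h < 6" | "h = 6" | "7 \<le> h" "h < 10" | "10 \<le> h"
    by linarith
  then show False
  proof cases
    case 1
    then have "f i \<in> {6..<13}" if "i < 8" for i
      using f(2)[OF that] spoke[OF that] by (auto simp: K6_bowtie_def)
    then have "f ` {..<8} \<subseteq> {6..<13}"
      by blast
    then show False
      using inj_card_contradiction[OF f(1), of "{6..<13}"] by simp
  next
    case 2
    then have "f i < 6" if "i < 8" for i
      using spoke[OF that] by (auto simp: K6_bowtie_def)
    then show False
      using small[of "{}"] by auto
  next
    case 3
    then have "f i < 6 \<or> f i \<in> {10..<13}" if "i < 8" for i
      using spoke[OF that] f(2)[OF that] by (auto simp: K6_bowtie_def)
    then show False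
      using small[of "{10..<13}"] by auto
  next
    case 4
    then have "f i < 6 \<or> f i \<in> {7..<10}" if "i < 8" for i
      using spoke[OF that] f(2)[OF that] by (auto simp: K6_bowtie_def)
    then show False
      using small[of "{7..<10}"] by auto
  qed
qed

text \<open>D is a star with three legs of length 2. Deleting a vertex leaves components of orders
  2, 2, 2 (centre), 1, 5 (middle of a leg) or 6 (end of a leg), and none of these can be grouped to
  give 3 vertices. \<open>P\<close> is constant on each component, so the sum is the size of such a
  group.\<close>

lemma tree_D_unbalanced:
  fixes P :: "nat \<Rightarrow> bool"
  assumes k: "k \<in> {1..7}"
    and P: "\<forall>(u, v) \<in> {(1,2), (2,3), (3,4), (4,5), (3,6), (6,7)}. u = k \<or> v = k \<or> P u = P v"
  shows "(\<Sum>i\<in>{1..7}. if i \<noteq> k \<and> P i then 1 else 0) \<noteq> (3 :: nat)"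
proof -
  have set: "{1..7} = {1,2,3,4,5,6,7::nat}"
    by auto
  have "k = 1 \<or> k = 2 \<or> k = 3 \<or> k = 4 \<or> k = 5 \<or> k = 6 \<or> k = 7"
    using k by auto
  then show ?thesis
    using P unfolding set by (elim disjE) auto
qed

text \<open>Being connected and too large for the K_6, a copy of D would span the other component,
  which also has seven vertices. Deleting the vertex sent to the cut vertex 6 would split the
  remaining six into 3 and 3, contrary to \<open>tree_D_unbalanced\<close>.\<close>

lemma K6_bowtie_no_tree_D:
  "\<not> contains_subgraph (graph_on 13 K6_bowtie)
     (graph_of {1..7::nat} {(1,2), (2,3), (3,4), (4,5), (3,6), (6,7)})"
    (is "\<not> contains_subgraph _ (graph_of _ ?E)")
proof
  assume "contains_subgraph (graph_on 13 K6_bowtie) (graph_of {1..7} ?E)"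
  then obtain f where f: "inj_on f {1..7}" "f ` {1..7} \<subseteq> {..<13}"
    and arc: "\<And>u v. (u, v) \<in> ?E \<Longrightarrow> K6_bowtie (f u) (f v)"
    by (rule graph_on_containsE[OF _ _ symp_K6_bowtie]) auto
  have set: "{1..7} = {1,2,3,4,5,6,7::nat}"
    by auto
  have "\<forall>(u, v) \<in> ?E. (f u < 6) = (f v < 6)"
    using arc by (fastforce simp: K6_bowtie_def)
  then have "\<forall>i\<in>{1..7}. (f i < 6) = (f 1 < 6)"
    unfolding set by auto
  moreover have "\<not> f ` {1..7} \<subseteq> {..<6}"
    using inj_card_contradiction[OF f(1), of "{..<6}"] by auto
  ultimately have "6 \<le> f i" if "i \<in> {1..7}" for i
    using that unfolding image_subset_iff by (metis lessThan_iff not_less)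
  then have "f ` {1..7} \<subseteq> {6..<13}"
    using f(2) unfolding image_subset_iff by simp
  then have img: "f ` {1..7} = {6..<13}"
    using card_subset_eq[of "{6..<13}" "f ` {1..7}"] card_image[OF f(1)] by simp
  have "6 \<in> f ` {1..7}"
    unfolding img by simp
  then obtain k where k: "k \<in> {1..7}" "f k = 6"
    by (metis imageE)
  have not_k: "f i = 6 \<longleftrightarrow> i = k" if "i \<in> {1..7}" for i
    using inj_onD[OF f(1)] that k by metis
  have "f ` {i \<in> {1..7}. i \<noteq> k \<and> f i < 10} = {7..<10}"
  proof
    show "f ` {i \<in> {1..7}. i \<noteq> k \<and> f i < 10} \<subseteq> {7..<10}"
    proof
      fix x
      assume "x \<in> f ` {i \<in> {1..7}. i \<noteq> k \<and> f i < 10}"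
      then obtain i where i: "i \<in> {1..7}" "i \<noteq> k" "f i < 10" "x = f i"
        by blast
      moreover have "f i \<in> {6..<13}"
        using img i(1) by blast
      moreover have "f i \<noteq> 6"
        using not_k i by blast
      ultimately show "x \<in> {7..<10}"
        by auto
    qed
    show "{7..<10} \<subseteq> f ` {i \<in> {1..7}. i \<noteq> k \<and> f i < 10}"
    proof
      fix x :: nat
      assume x: "x \<in> {7..<10}"
      then have "x \<in> f ` {1..7}"
        unfolding img by simp
      then show "x \<in> f ` {i \<in> {1..7}. i \<noteq> k \<and> f i < 10}"
        using x k(2) by auto
    qed
  qed
  moreover have "inj_on f {i \<in> {1..7}. i \<noteq> k \<and> f i < 10}"
    by (rule inj_on_subset[OF f(1)]) auto
  ultimately have "card {i \<in> {1..7}. i \<noteq> k \<and> f i < 10} = 3"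
    using card_image by fastforce
  then have "(\<Sum>i\<in>{1..7}. if i \<noteq> k \<and> f i < 10 then 1 else 0) = (3 :: nat)"
    by (simp add: sum.If_cases Int_def)
  moreover have "u = k \<or> v = k \<or> (f u < 10) = (f v < 10)" if "(u, v) \<in> ?E" for u v
  proof -
    have "u \<in> {1..7}" "v \<in> {1..7}"
      using that by auto
    then show ?thesis
      using arc[OF that] not_k[of u] not_k[of v] by (auto simp: K6_bowtie_def)
  qed
  then have "\<forall>(u, v) \<in> ?E. u = k \<or> v = k \<or> (f u < 10) = (f v < 10)"
    by blast
  ultimately show False
    using tree_D_unbalanced[OF k(1), of "\<lambda>i. f i < 10"] by blast
qed

section \<open>K_6 together with K_{4,4}, against the tree E\<close>

definition K6_K44 :: "nat \<Rightarrow> nat \<Rightarrow> bool" where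
  "K6_K44 u v \<longleftrightarrow> u < 6 \<and> v < 6 \<or> 6 \<le> u \<and> 6 \<le> v \<and> (u < 10 \<longleftrightarrow> \<not> v < 10)"

lemma symp_K6_K44: "symp K6_K44"
  by (auto simp: symp_def K6_K44_def)

text \<open>The classes of the K_{4,4} are 6, ..., 9 and 10, ..., 13; in the complement each is a
  K_4, with no edge between them. If the hub is in the K_6, the rim would be an 8-cycle in these two
  K_4. Otherwise the rim lies in the K_6, independent in the complement, and the three other
  vertices of the hub's class, too few to cover the rim edges.\<close>

lemma K6_K44_no_wheel: "\<not> contains_subgraph (complement (graph_on 14 K6_K44)) (wheel 8)"
proof
  assume "contains_subgraph (complement (graph_on 14 K6_K44)) (wheel 8)"
  then obtain f :: "nat \<Rightarrow> nat" and h where f: "inj_on f {..<8}" "\<And>i. i < 8 \<Longrightarrow> f i < 14 \<and> f i \<noteq> h" "h < 14"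
    and rim: "\<And>i. i < 8 \<Longrightarrow> \<not> K6_K44 (f i) (f ((i + 1) mod 8))"
    and spoke: "\<And>i. i < 8 \<Longrightarrow> \<not> K6_K44 (f i) h"
    by (rule complement_graph_on_wheel8E[OF _ symp_K6_K44]) blast
  have mod: "(i + 1) mod 8 < 8" for i :: nat by simp
  have False if sub: "\<And>i. i < 8 \<Longrightarrow> f i < 6 \<or> f i \<in> S" "finite S" "card S < 4" for S
  proof -
    have "f i \<in> S \<or> f ((i + 1) mod 8) \<in> S" if "i < 8" for i
      using sub(1)[OF that] sub(1)[OF mod] rim[OF that] by (auto simp: K6_K44_def)
    from rim_card[OF f(1) this sub(2)] show False
      using sub(3) by simp
  qed note small = this
  consider "h < 6" | "6 \<le> h" "h < 10" | "10 \<le> h"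
    by linarith
  then show False
  proof cases
    case 1
    then have ge: "f i \<ge> 6" if "i < 8" for i
      using spoke[OF that] by (auto simp: K6_K44_def)
    have step: "(f i < 10) = (f ((i + 1) mod 8) < 10)" if "i < 8" for i
      using rim[OF that] ge[OF that] ge[OF mod] by (auto simp: K6_K44_def)
    \<comment> \<open>Walking along the rim never changes the class, so eight distinct vertices
      would lie in a class of four.\<close>
    have "(f i < 10) = (f 0 < 10)" if "i < 8" for i
      using that
    proof (induction i)
      case (Suc i)
      then show ?case using step[of i] by simp
    qed simp
    then have "(\<forall>i<8. f i < 10) \<or> (\<forall>i<8. 10 \<le> f i)"
      by (metis not_less)
    then have "f ` {..<8} \<subseteq> {6..<10} \<or> f ` {..<8} \<subseteq> {10..<14}"
      using f(2) ge unfolding image_subset_iff by (simp add: Ball_def)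
    then show False
      using inj_card_contradiction[OF f(1), of "{6..<10}"]
        inj_card_contradiction[OF f(1), of "{10..<14}"] by auto
  next
    case 2
    then have "f i < 6 \<or> f i \<in> {6..<10} - {h}" if "i < 8" for i
      using spoke[OF that] f(2)[OF that] by (auto simp: K6_K44_def)
    moreover have "card ({6..<10} - {h}) = 3"
      using 2 by simp
    ultimately show False
      using small[of "{6..<10} - {h}"] by auto
  next
    case 3
    then have "f i < 6 \<or> f i \<in> {10..<14} - {h}" if "i < 8" for i
      using spoke[OF that] f(2)[OF that] by (auto simp: K6_K44_def)
    moreover have "card ({10..<14} - {h}) = 3"
      using 3 f(3) by simp
    ultimately show False
      using small[of "{10..<14} - {h}"] by auto
  qed
qed

text \<open>E is connected, so it would have to lie in the K_{4,4}. Its vertices 1, 3, 5, 6, 7 form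
  one colour class and would have to fit into a class of size 4.\<close>

lemma K6_K44_no_tree_E:
  "\<not> contains_subgraph (graph_on 14 K6_K44)
     (graph_of {1..7::nat} {(1,2), (2,3), (3,4), (4,5), (2,6), (4,7)})"
    (is "\<not> contains_subgraph _ (graph_of _ ?E)")
proof
  assume "contains_subgraph (graph_on 14 K6_K44) (graph_of {1..7} ?E)"
  then obtain f where f: "inj_on f {1..7}" "f ` {1..7} \<subseteq> {..<14}"
    and arc: "\<And>u v. (u, v) \<in> ?E \<Longrightarrow> K6_K44 (f u) (f v)"
    by (rule graph_on_containsE[OF _ _ symp_K6_K44]) auto
  have set: "{1..7} = {1,2,3,4,5,6,7::nat}" "{1,3,5,6,7} \<subseteq> {1..7::nat}"
    by auto
  have "\<forall>(u, v) \<in> ?E. (f u < 6) = (f v < 6)"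
    using arc by (fastforce simp: K6_K44_def)
  then have "\<forall>i\<in>{1..7}. (f i < 6) = (f 1 < 6)"
    unfolding set(1) by auto
  moreover have "\<not> f ` {1..7} \<subseteq> {..<6}"
    using inj_card_contradiction[OF f(1), of "{..<6}"] by auto
  ultimately have ge: "6 \<le> f i" if "i \<in> {1..7}" for i
    using that unfolding image_subset_iff by (metis lessThan_iff not_less)
  have "(f u < 10) = (\<not> f v < 10)" if "(u, v) \<in> ?E" for u v
  proof -
    have "u \<in> {1..7}" "v \<in> {1..7}"
      using that by auto
    then show ?thesis
      using arc[OF that] ge[of u] ge[of v] by (auto simp: K6_K44_def)
  qed
  then have "\<forall>(u, v) \<in> ?E. (f u < 10) = (\<not> f v < 10)"
    by blast
  then have "\<forall>i\<in>{1,3,5,6,7}. (f i < 10) = (f 1 < 10)"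
    by auto
  then have "(\<forall>i\<in>{1,3,5,6,7}. f i < 10) \<or> (\<forall>i\<in>{1,3,5,6,7}. 10 \<le> f i)"
    by (metis not_less)
  moreover have "6 \<le> f i \<and> f i < 14" if "i \<in> {1,3,5,6,7}" for i
    using f(2) ge[of i] subsetD[OF set(2) that] unfolding image_subset_iff by blast
  ultimately have "f ` {1,3,5,6,7} \<subseteq> {6..<10} \<or> f ` {1,3,5,6,7} \<subseteq> {10..<14}"
    unfolding image_subset_iff by simp
  then show False
    using inj_card_contradiction[OF inj_on_subset[OF f(1) set(2)], of "{6..<10}"]
      inj_card_contradiction[OF inj_on_subset[OF f(1) set(2)], of "{10..<14}"] by auto
qed

section \<open>Certificates\<close>

definition edges_A :: edges where
  "edges_A = [(1,2), (2,3), (3,4), (4,5), (5,6), (2,7)]"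

text \<open>Number 0 is the red tree and number 1 the blue 8-cycle. With degree and exit parameters
  0, only \<open>Split\<close> and \<open>Cite\<close> can succeed. The entries exclude ever smaller
  red graphs: number 4 is the path on six vertices, which is A without its leaf 7, and number 8 is a
  path on four vertices with a disjoint edge.\<close>

definition ramsey_cert_A :: "(nat \<times> pattern \<times> cert) list" where
  "ramsey_cert_A =
   [(2, ([0,1,2,3,4,5,6,7,8,9], [(1,2),(1,8),(3,4),(3,7),(4,8)], [(0,7),(0,8),(6,8),(7,9)]), Split
     1 6 (Cite 0 [6,1,8,4,3,7,2]) (Split 3 9 (Cite 0 [9,3,4,8,1,2,7]) (Split 3 5 (Cite 0
     [5,3,4,8,1,2,7]) (Split 1 5 (Cite 0 [5,1,8,4,3,7,2]) (Cite 1 [1,5,3,9,7,0,8,6]))))),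
   (4, ([0,1,2,3,4,5,6,7,8,9], [(1,8),(3,4),(3,7),(4,8),(5,7)], []), Split 0 7 (Cite 0
     [0,7,3,4,8,1,5]) (Split 8 9 (Cite 0 [9,8,4,3,7,5,1]) (Split 6 7 (Cite 0 [6,7,3,4,8,1,5])
     (Split 2 7 (Cite 0 [2,7,3,4,8,1,5]) (Split 0 8 (Cite 0 [0,8,4,3,7,5,1]) (Split 7 9 (Cite 0
     [9,7,3,4,8,1,5]) (Split 2 8 (Cite 0 [2,8,4,3,7,5,1]) (Split 6 8 (Cite 0 [6,8,4,3,7,5,1])
     (Split 0 1 (Cite 2 [2,1,0,3,4,5,6,7,8,9]) (Split 1 9 (Cite 2 [0,1,9,3,4,5,2,7,8,6]) (Split 5
     6 (Cite 2 [0,5,6,4,3,1,2,8,7,9]) (Split 5 9 (Cite 2 [0,5,9,4,3,1,2,8,7,6]) (Cite 1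
     [5,9,1,0,7,2,8,6]))))))))))))),
   (5, ([0,1,2,3,4,5,6,7,8,9], [(1,8),(2,4),(3,4),(3,7),(5,7)], [(1,4),(4,8)]), Split 7 8 (Cite 4
     [0,2,5,7,3,1,6,8,4,9]) (Split 2 9 (Cite 4 [0,9,1,3,4,5,6,7,2,8]) (Split 0 5 (Cite 4
     [1,0,6,3,7,2,8,4,5,9]) (Split 5 9 (Cite 4 [0,9,1,3,7,2,6,4,5,8]) (Split 5 6 (Cite 4
     [0,6,1,3,7,2,8,4,5,9]) (Split 1 2 (Cite 4 [0,1,6,3,4,5,8,7,2,9]) (Split 6 7 (Split 0 7 (Split
     0 8 (Cite 4 [1,8,5,3,7,2,6,4,0,9]) (Split 0 6 (Cite 4 [1,0,5,3,7,2,8,4,6,9]) (Cite 1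
     [0,6,5,9,2,1,4,8]))) (Cite 1 [0,7,8,4,1,2,9,5])) (Cite 1 [6,7,8,4,1,2,9,5])))))))),
   (6, ([0,1,2,3,4,5,6,7,8,9], [(1,8),(2,8),(3,4),(3,7),(5,7)],
     [(0,4),(0,5),(2,5),(4,6),(4,8),(5,8)]), Split 2 3 (Cite 4 [0,5,4,2,3,1,6,8,7,9]) (Split 1 3
     (Cite 4 [0,5,4,1,3,2,6,8,7,9]) (Split 1 7 (Cite 4 [0,4,5,1,7,2,6,8,3,9]) (Split 7 8 (Split 0
     1 (Cite 4 [2,0,5,7,8,4,6,3,1,9]) (Split 2 6 (Cite 4 [0,6,1,7,8,4,5,3,2,9]) (Cite 1
     [2,6,4,8,5,0,1,3]))) (Cite 1 [7,8,4,0,5,2,3,1]))))),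
   (8, ([0,1,2,3,4,5,6,7,8,9], [(1,8),(3,4),(3,7),(5,7)], []), Split 4 8 (Cite 4
     [0,1,2,3,4,5,6,7,8,9]) (Split 1 4 (Cite 4 [0,5,2,4,3,8,6,1,7,9]) (Split 1 5 (Cite 4
     [0,4,2,5,7,8,6,1,3,9]) (Split 5 8 (Cite 4 [0,4,2,5,7,1,6,8,3,9]) (Split 0 5 (Cite 5
     [2,1,0,7,5,4,6,3,8,9]) (Split 4 6 (Cite 5 [0,1,6,3,4,5,2,7,8,9]) (Split 0 4 (Cite 5
     [2,1,0,3,4,5,6,7,8,9]) (Split 2 5 (Cite 5 [0,1,2,7,5,4,6,3,8,9]) (Split 2 8 (Cite 6
     [0,1,2,3,4,5,6,7,8,9]) (Split 8 9 (Cite 6 [0,9,1,7,5,4,2,3,8,6]) (Split 1 9 (Cite 6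
     [0,9,8,7,5,4,2,3,1,6]) (Split 1 6 (Cite 6 [0,6,8,7,5,4,2,3,1,9]) (Cite 1
     [1,6,4,0,5,2,8,9]))))))))))))),
   (9, ([0,1,2,3,4,5,6,7,8,9], [(1,8),(2,8),(3,7)], [(0,3),(3,6),(4,5),(5,6)]), Split 1 9 (Cite 8
     [0,3,4,1,9,2,5,8,7,6]) (Split 0 1 (Cite 8 [4,3,5,1,0,2,6,8,7,9]) (Split 2 4 (Cite 8
     [0,3,5,2,4,1,6,8,7,9]) (Split 2 9 (Cite 8 [0,3,4,2,9,1,5,8,7,6]) (Cite 1
     [2,9,1,0,3,6,5,4]))))),
   (10, ([0,1,2,3,4,5,6,7,8,9], [(1,8),(3,7),(5,7)], [(3,4)]), Split 0 5 (Cite 8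
     [2,1,4,5,0,3,6,7,8,9]) (Split 5 6 (Cite 8 [0,1,2,5,6,3,4,7,8,9]) (Split 2 3 (Cite 8
     [0,1,4,3,2,5,6,7,8,9]) (Split 3 6 (Cite 8 [0,1,2,3,6,5,4,7,8,9]) (Split 0 3 (Cite 8
     [2,1,4,3,0,5,6,7,8,9]) (Split 3 9 (Cite 8 [0,1,2,3,9,5,4,7,8,6]) (Split 4 5 (Cite 8
     [0,1,2,5,4,3,6,7,8,9]) (Split 2 8 (Cite 9 [0,1,2,3,4,5,6,7,8,9]) (Split 1 2 (Cite 9
     [4,2,8,3,6,5,0,7,1,9]) (Split 4 8 (Cite 9 [2,4,1,3,6,5,0,7,8,9]) (Split 1 9 (Cite 9
     [2,9,8,3,4,5,0,7,1,6]) (Cite 1 [1,9,3,0,5,4,8,2])))))))))))),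
   (11, ([0,1,2,3,4,5,6,7,8,9], [(1,8),(3,7)], [(5,7)]), Split 3 4 (Cite 10 [0,1,2,7,5,4,6,3,8,9])
     (Split 0 3 (Cite 10 [2,1,4,7,5,0,6,3,8,9]) (Split 0 7 (Cite 10 [2,1,5,3,4,0,6,7,8,9]) (Split
     7 9 (Cite 10 [2,1,4,3,0,9,5,7,8,6]) (Split 6 7 (Cite 10 [2,1,4,3,0,6,5,7,8,9]) (Split 3 5
     (Cite 10 [2,1,4,7,0,5,6,3,8,9]) (Split 8 9 (Split 1 5 (Cite 8 [0,3,2,1,5,9,4,8,7,6]) (Cite 10
     [0,3,2,1,5,9,4,8,7,6])) (Split 1 6 (Cite 10 [0,3,2,8,9,6,4,1,7,5]) (Split 4 8 (Cite 10
     [0,3,2,1,6,4,5,8,7,9]) (Split 1 5 (Cite 10 [0,3,2,8,4,5,6,1,7,9]) (Cite 1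
     [1,5,3,4,8,9,7,6]))))))))))),
   (12, ([0,1,2,3,4,5,6,7,8,9], [(1,8)], [(3,7)]), Split 2 7 (Cite 11 [0,1,4,2,5,3,6,7,8,9])
     (Split 2 3 (Cite 11 [0,1,4,2,5,7,6,3,8,9]) (Split 5 7 (Cite 11 [0,1,3,5,4,2,6,7,8,9]) (Split
     3 6 (Cite 11 [0,1,4,6,5,2,7,3,8,9]) (Split 2 6 (Cite 11 [0,1,4,2,5,3,7,6,8,9]) (Split 2 4
     (Cite 11 [0,1,5,4,6,3,7,2,8,9]) (Split 2 5 (Cite 11 [0,1,3,2,4,7,6,5,8,9]) (Split 0 6 (Cite
     11 [3,1,4,0,5,2,7,6,8,9]) (Split 2 9 (Cite 11 [0,1,4,9,5,3,6,2,8,7]) (Split 3 9 (Cite 11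
     [0,1,4,3,5,2,6,9,8,7]) (Split 6 9 (Cite 11 [0,1,3,6,4,2,5,9,8,7]) (Split 0 4 (Cite 11
     [3,1,5,0,6,2,7,4,8,9]) (Cite 1 [0,4,2,5,7,3,9,6]))))))))))))),
   (15, ([0,1,2,3,4,5,6,7,8,9], [], []), Split 1 8 (Split 3 7 (Split 5 7 (Split 3 4 (Cite 8
     [0,1,2,3,4,5,6,7,8,9]) (Cite 10 [0,1,2,3,4,5,6,7,8,9])) (Cite 11 [0,1,2,3,4,5,6,7,8,9]))
     (Cite 12 [0,1,2,3,4,5,6,7,8,9])) (Split 3 7 (Cite 12 [0,3,2,1,4,5,6,8,7,9]) (Split 4 6 (Cite
     12 [0,4,2,1,3,5,7,8,6,9]) (Split 6 7 (Cite 12 [0,6,2,1,3,4,5,8,7,9]) (Split 1 6 (Cite 12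
     [0,1,2,3,4,5,8,7,6,9]) (Split 2 7 (Cite 12 [0,2,3,1,4,5,8,6,7,9]) (Split 0 7 (Cite 12
     [2,0,3,1,4,5,8,6,7,9]) (Split 1 4 (Cite 12 [2,1,3,0,5,6,8,7,4,9]) (Split 8 9 (Cite 12
     [1,8,2,0,3,4,5,7,9,6]) (Split 5 9 (Cite 12 [1,5,2,0,3,4,6,7,9,8]) (Split 2 5 (Cite 12
     [1,2,3,0,4,6,8,7,5,9]) (Cite 1 [2,5,9,8,1,4,6,7]))))))))))))]"

lemma check_ramsey_cert_A:
  "check_all 0 0 [(0, tree_pattern edges_A), (1, cycle_pattern)] ([0,1,2,3,4,5,6,7,8,9], [], [])
     ramsey_cert_A"
  by code_simp

text \<open>Numbers 12, 19 and 22 exclude K_4, K_4 minus an edge, and a triangle with a pendant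
  edge. After that the graph is triangle-free, and number 30 explores it from an arbitrary vertex.
  \<open>Exit\<close> is indispensable at K_4, whose vertices already have degree 3.\<close>

definition degree_cert_A :: "(nat \<times> pattern \<times> cert) list" where
  "degree_cert_A =
   [(1, ([0,1,2,3,4,5], [(0,1),(0,2),(1,2),(1,3),(1,4),(1,5),(2,3),(2,4),(3,4),(3,5),(4,5)], []),
     Exit 6 [(0, Cite 0 [1,0,2,3,4,5,6]), (1, Cite 0 [0,1,2,3,4,5,6]), (2, Cite 0
     [0,1,3,4,2,6,5]), (3, Cite 0 [0,1,2,4,3,6,5]), (4, Cite 0 [0,1,2,3,4,6,5]), (5, Cite 0
     [0,1,2,3,5,6,4])]),
   (4, ([0,1,2,3,4,5], [(0,1),(0,2),(0,3),(0,5),(1,2),(1,4),(1,5),(2,3),(3,4),(3,5)], []), Exit 6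
     [(0, Cite 0 [2,0,1,4,3,5,6]), (1, Cite 0 [2,0,3,4,1,6,5]), (2, Cite 0 [0,1,4,3,2,6,5]), (3,
     Cite 0 [2,0,1,4,3,6,5]), (4, Cite 0 [0,1,2,3,4,6,5]), (5, Cite 0 [0,1,2,3,5,6,4])]),
   (5, ([0,1,2,3,4,5], [(0,1),(0,2),(0,3),(0,4),(0,5),(1,2),(1,3),(1,4),(2,3),(3,4)], []), Split 4
     5 (Cite 1 [5,0,4,1,3,2]) (Split 2 5 (Cite 1 [5,0,2,1,3,4]) (Split 3 5 (Cite 4 [1,0,2,3,5,4])
     (Split 1 5 (Cite 4 [3,1,2,0,5,4]) (Nbr 5 6 (Cite 0 [1,3,2,0,5,6,4])))))),
   (6, ([0,1,2,3,4,5], [(0,1),(0,2),(0,3),(0,4),(1,2),(1,3),(1,4),(2,3),(2,5),(3,4)], []), Split 4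
     5 (Cite 4 [0,4,1,2,5,3]) (Split 3 5 (Cite 5 [3,0,2,1,4,5]) (Split 1 5 (Cite 5 [1,0,2,3,4,5])
     (Split 0 5 (Cite 5 [0,1,2,3,4,5]) (Nbr 5 6 (Cite 0 [0,1,3,2,5,6,4])))))),
   (7, ([0,1,2,3,4], [(0,1),(0,2),(0,3),(0,4),(1,2),(1,3),(1,4),(2,3),(3,4)], []), Exit 5 [(0,
     Cite 5 [0,1,2,3,4,5]), (1, Cite 5 [1,0,2,3,4,5]), (2, Cite 6 [0,1,2,3,4,5]), (3, Cite 5
     [3,0,2,1,4,5]), (4, Cite 6 [0,1,4,3,2,5])]),
   (8, ([0,1,2,3,4,5], [(0,1),(0,2),(1,2),(1,3),(1,5),(2,3),(3,4),(4,5)], []), Exit 6 [(0, Cite 0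
     [1,0,2,3,4,5,6]), (1, Cite 0 [0,1,2,3,4,5,6]), (2, Cite 0 [0,2,1,3,4,5,6]), (3, Cite 0
     [0,1,5,4,3,6,2]), (4, Cite 0 [0,1,2,3,4,6,5]), (5, Cite 0 [0,1,3,4,5,6,2])]),
   (10, ([0,1,2,3,4], [(0,1),(0,2),(0,3),(0,4),(1,2),(1,3),(2,3),(3,4)], []), Split 1 4 (Cite 7
     [0,1,2,3,4]) (Split 2 4 (Cite 7 [2,0,4,3,1]) (Nbr 4 5 (Split 1 5 (Cite 8 [0,1,2,3,4,5])
     (Split 0 5 (Cite 8 [5,0,4,3,1,2]) (Split 2 5 (Cite 8 [1,2,0,3,4,5]) (Split 3 5 (Cite 8
     [5,3,4,0,1,2]) (Nbr 5 6 (Cite 0 [0,1,3,4,5,6,2]))))))))),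
   (11, ([0,1,2,3,4], [(0,1),(0,2),(0,3),(0,4),(1,2),(1,3),(2,3)], []), Split 3 4 (Cite 10
     [0,1,2,3,4]) (Split 2 4 (Cite 10 [2,1,3,0,4]) (Split 1 4 (Cite 10 [1,2,3,0,4]) (Nbr 4 5 (Nbr
     4 6 (Cite 0 [5,4,0,1,2,3,6])))))),
   (12, ([0,1,2,3], [(0,1),(0,2),(0,3),(1,2),(1,3),(2,3)], []), Exit 4 [(0, Cite 11 [0,1,2,3,4]),
     (1, Cite 11 [1,0,2,3,4]), (2, Cite 11 [2,0,1,3,4]), (3, Cite 11 [3,0,1,2,4])]),
   (14, ([0,1,2,3,4,5], [(0,1),(0,2),(0,3),(0,4),(1,2),(1,4),(1,5),(2,3),(3,4)], []), Split 2 5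
     (Cite 8 [5,2,1,0,4,3]) (Split 3 5 (Cite 8 [4,3,0,2,1,5]) (Split 4 5 (Cite 8 [5,4,1,0,2,3])
     (Split 0 5 (Cite 8 [5,0,1,2,3,4]) (Nbr 5 6 (Cite 0 [0,3,2,1,5,6,4])))))),
   (16, ([0,1,2,3,4], [(0,1),(0,2),(0,3),(0,4),(1,2),(1,4),(2,3)], [(1,3)]), Split 2 4 (Cite 12
     [2,4,0,1]) (Split 3 4 (Exit 5 [(0, Split 2 5 (Cite 8 [5,2,0,1,4,3]) (Split 1 5 (Cite 8
     [5,1,0,2,3,4]) (Split 3 5 (Cite 8 [5,3,0,2,1,4]) (Split 4 5 (Cite 8 [5,4,0,1,2,3]) (Nbr 5 6
     (Nbr 5 7 (Cite 0 [6,5,0,1,2,3,7]))))))), (1, Cite 14 [0,1,2,3,4,5]), (2, Cite 14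
     [0,2,1,4,3,5]), (3, Cite 14 [0,3,2,1,4,5]), (4, Cite 14 [0,4,1,2,3,5])]) (Nbr 3 5 (Split 4 5
     (Cite 8 [2,0,1,4,5,3]) (Nbr 4 6 (Cite 0 [0,3,2,1,4,6,5])))))),
   (17, ([0,1,2,3,4,5], [(0,1),(0,2),(1,2),(1,4),(1,5),(2,3),(3,4),(3,5),(4,5)], []), Exit 6 [(0,
     Cite 0 [1,0,2,3,4,5,6]), (1, Cite 0 [0,1,2,3,4,5,6]), (2, Cite 0 [0,1,4,3,2,6,5]), (3, Cite 0
     [0,1,4,5,3,6,2]), (4, Cite 0 [0,1,2,3,4,6,5]), (5, Cite 0 [0,1,2,3,5,6,4])]),
   (19, ([0,1,2,3], [(0,1),(0,2),(0,3),(1,2),(2,3)], []), Split 1 3 (Cite 12 [0,1,2,3]) (Nbr 1 4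
     (Split 0 4 (Cite 16 [0,1,2,3,4]) (Split 2 4 (Cite 16 [2,0,1,4,3]) (Nbr 4 5 (Split 0 5 (Cite 8
     [3,0,2,1,4,5]) (Split 2 5 (Cite 8 [3,2,0,1,4,5]) (Split 3 5 (Split 3 4 (Cite 17
     [5,3,4,1,0,2]) (Nbr 4 6 (Cite 0 [0,2,3,5,4,6,1]))) (Nbr 5 6 (Cite 0
     [0,2,1,4,5,6,3])))))))))),
   (20, ([0,1,2,3,4,5], [(0,1),(0,2),(1,2),(1,4),(2,5),(3,4),(3,5)], []), Exit 6 [(0, Cite 0
     [1,0,2,5,3,4,6]), (1, Cite 0 [0,1,2,5,3,4,6]), (2, Cite 0 [0,2,1,4,3,5,6]), (3, Cite 0
     [0,1,2,5,3,6,4]), (4, Cite 0 [0,2,5,3,4,6,1]), (5, Cite 0 [0,1,4,3,5,6,2])]),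
   (22, ([0,1,2,3], [(0,1),(0,2),(0,3),(1,2)], []), Split 2 3 (Cite 19 [0,1,2,3]) (Split 1 3 (Cite
     19 [1,3,0,2]) (Nbr 1 4 (Split 2 4 (Cite 19 [2,4,1,0]) (Nbr 2 5 (Split 3 4 (Split 3 5 (Cite 20
     [0,2,1,3,5,4]) (Nbr 3 6 (Cite 0 [0,2,1,4,3,6,5]))) (Nbr 3 6 (Split 3 5 (Cite 0
     [5,3,0,2,1,4,6]) (Nbr 3 7 (Cite 0 [6,3,0,1,2,5,7])))))))))),
   (25, ([0,1,2,3,4,5], [(0,1),(0,2),(0,3),(1,4),(1,5),(2,4)], [(1,2),(1,3),(2,3)]), Split 3 5
     (Split 2 5 (Split 3 4 (Exit 6 [(0, Cite 0 [1,0,2,4,3,5,6]), (1, Cite 0 [0,1,4,2,5,3,6]), (2,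
     Cite 0 [0,2,4,1,5,3,6]), (3, Cite 0 [0,3,4,1,5,2,6]), (4, Cite 0 [1,4,2,0,3,5,6]), (5, Cite 0
     [1,5,2,0,3,4,6])]) (Nbr 3 6 (Cite 0 [0,3,5,1,4,2,6]))) (Nbr 2 6 (Cite 0 [0,2,4,1,5,3,6])))
     (Nbr 3 6 (Split 2 6 (Cite 0 [4,1,0,2,6,3,5]) (Split 1 6 (Cite 0 [6,1,4,2,0,3,5]) (Split 0 6
     (Cite 22 [0,6,3,1]) (Split 4 6 (Split 3 4 (Cite 22 [3,4,6,0]) (Nbr 3 7 (Cite 0
     [0,1,4,6,3,7,5]))) (Nbr 6 7 (Cite 0 [4,1,0,3,6,7,5])))))))),
   (30, ([0], [], []), Nbr 0 1 (Nbr 0 2 (Nbr 0 3 (Split 1 2 (Cite 22 [0,1,2,3]) (Split 2 3 (Cite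
     22 [0,2,3,1]) (Split 1 3 (Cite 22 [0,1,3,2]) (Nbr 1 4 (Split 0 4 (Cite 22 [0,4,1,2]) (Nbr 1 5
     (Split 4 5 (Cite 22 [1,4,5,0]) (Split 2 4 (Cite 25 [0,1,2,3,4,5]) (Split 2 5 (Cite 25
     [0,1,2,3,5,4]) (Split 3 4 (Cite 25 [0,1,3,2,4,5]) (Split 3 5 (Cite 25 [0,1,3,2,5,4]) (Nbr 2 6
     (Split 3 6 (Cite 0 [4,1,0,3,6,2,5]) (Nbr 2 7 (Split 4 6 (Cite 0 [0,1,4,6,2,7,5]) (Split 3 7
     (Cite 0 [4,1,0,3,7,2,5]) (Split 4 7 (Cite 0 [0,1,4,7,2,6,5]) (Nbr 3 8 (Split 4 8 (Cite 0
     [6,2,0,1,4,8,7]) (Nbr 3 9 (Split 4 9 (Cite 0 [0,1,4,9,3,8,5]) (Nbr 4 10 (Cite 0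
     [6,2,0,1,4,10,7]))))))))))))))))))))))))))]"

lemma check_degree_cert_A:
  "check_all 3 6 [(0, tree_pattern edges_A)] ([0], [], []) degree_cert_A"
  by code_simp

section \<open>Case distinctions for the tree B\<close>

definition edges_B :: edges where
  "edges_B = [(1,2), (2,3), (3,4), (4,5), (5,6), (3,7)]"

text \<open>Number 5 is B without its leaf 1, number 16 a path on three vertices with a disjoint
  edge, and number 19 a single red edge. Once that is excluded, everything is blue.\<close>

definition ramsey_cert_B :: "(nat \<times> pattern \<times> cert) list" where
  "ramsey_cert_B =
   [(2, ([0,1,2,3,4,5,6,7,8,9], [(0,8),(1,4),(1,5),(3,8),(4,8),(5,6)], [(0,9),(2,3)]), Split 3 5
     (Cite 0 [4,1,5,3,8,0,6]) (Split 4 7 (Cite 0 [0,8,4,1,5,6,7]) (Split 0 5 (Cite 0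
     [4,1,5,0,8,3,6]) (Split 1 9 (Cite 0 [6,5,1,4,8,0,9]) (Split 1 7 (Cite 0 [6,5,1,4,8,0,7])
     (Split 2 4 (Cite 0 [0,8,4,1,5,6,2]) (Cite 1 [2,4,7,1,9,0,5,3]))))))),
   (3, ([0,1,2,3,4,5,6,7,8,9], [(0,8),(1,4),(1,5),(1,9),(3,8),(4,8)],
     [(0,2),(0,6),(2,3),(3,6),(3,7),(5,7)]), Split 2 9 (Cite 0 [2,9,1,4,8,0,5]) (Split 4 5 (Cite 2
     [0,5,2,3,4,1,9,7,8,6]) (Split 4 9 (Cite 2 [0,9,2,3,4,1,5,7,8,6]) (Cite 1
     [4,9,2,0,6,3,7,5])))),
   (5, ([0,1,2,3,4,5,6,7,8,9], [(0,8),(1,4),(1,5),(3,8),(4,8)], []), Split 3 7 (Cite 0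
     [7,3,8,4,1,5,0]) (Split 2 3 (Cite 0 [2,3,8,4,1,5,0]) (Split 0 9 (Cite 0 [9,0,8,4,1,5,3])
     (Split 0 6 (Cite 0 [6,0,8,4,1,5,3]) (Split 3 6 (Cite 0 [6,3,8,4,1,5,0]) (Split 0 7 (Cite 0
     [7,0,8,4,1,5,3]) (Split 0 2 (Cite 0 [2,0,8,4,1,5,3]) (Split 5 9 (Cite 2
     [0,1,2,3,4,5,9,7,8,6]) (Split 5 7 (Cite 2 [0,1,2,3,4,5,7,9,8,6]) (Split 1 9 (Cite 3
     [0,1,2,3,4,5,6,7,8,9]) (Split 1 2 (Cite 3 [3,1,6,0,4,5,7,9,8,2]) (Cite 1
     [1,2,0,6,3,7,5,9])))))))))))),
   (6, ([0,1,2,3,4,5,6,7,8,9], [(1,4),(1,5),(4,8),(5,7)], [(1,3),(1,9),(2,8),(3,8)]), Split 4 9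
     (Cite 5 [9,5,0,8,1,7,2,3,4,6]) (Split 4 6 (Cite 5 [6,5,0,8,1,7,2,3,4,9]) (Split 5 6 (Cite 5
     [6,4,0,7,1,8,2,3,5,9]) (Split 2 5 (Cite 5 [2,4,0,7,1,8,3,6,5,9]) (Cite 1
     [2,5,6,4,9,1,3,8]))))),
   (8, ([0,1,2,3,4,5,6,7,8,9], [(0,8),(1,4),(1,5),(4,8)], [(3,8)]), Split 1 7 (Cite 5
     [7,8,2,5,4,0,3,6,1,9]) (Split 2 8 (Cite 5 [2,1,3,0,4,5,6,7,8,9]) (Split 1 6 (Cite 5
     [6,8,2,5,4,0,3,7,1,9]) (Split 1 2 (Cite 5 [2,8,3,5,4,0,6,7,1,9]) (Split 7 8 (Cite 5
     [7,1,2,0,4,5,3,6,8,9]) (Split 1 3 (Cite 5 [3,8,2,5,4,0,6,7,1,9]) (Split 6 8 (Cite 5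
     [6,1,2,0,4,5,3,7,8,9]) (Split 5 9 (Cite 6 [0,1,3,2,4,5,7,9,8,6]) (Split 3 5 (Cite 6
     [0,1,6,2,4,5,9,3,8,7]) (Split 0 9 (Cite 6 [5,8,3,2,4,0,7,9,1,6]) (Split 0 6 (Cite 6
     [5,8,3,2,4,0,9,6,1,7]) (Cite 1 [0,6,1,2,8,3,5,9])))))))))))),
   (9, ([0,1,2,3,4,5,6,7,8,9], [(0,8),(1,4),(1,5),(2,4)], [(0,4),(0,5),(4,8),(5,8)]), Split 5 7
     (Cite 8 [7,4,3,0,1,2,6,8,5,9]) (Split 2 8 (Cite 8 [0,4,3,5,2,1,6,7,8,9]) (Split 3 5 (Cite 8
     [3,4,6,0,1,2,7,8,5,9]) (Split 1 8 (Cite 8 [0,4,3,5,1,2,6,7,8,9]) (Split 2 3 (Cite 8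
     [3,1,0,8,4,5,6,7,2,9]) (Split 0 1 (Cite 8 [8,4,3,5,1,2,6,7,0,9]) (Split 4 7 (Split 1 7 (Cite
     8 [2,1,3,0,7,5,6,8,4,9]) (Cite 1 [1,7,5,3,2,8,4,0])) (Cite 1 [4,7,5,3,2,8,1,0])))))))),
   (10, ([0,1,2,3,4,5,6,7,8,9], [(0,8),(1,4),(1,5),(2,8)], [(0,4),(2,4),(3,4),(3,5),(4,6),(5,9)]),
     Split 0 1 (Cite 5 [4,8,3,5,0,2,6,7,1,9]) (Split 1 2 (Cite 5 [4,8,3,5,2,0,6,7,1,9]) (Split 0 9
     (Cite 9 [1,8,9,3,0,2,5,6,4,7]) (Split 2 6 (Cite 9 [1,8,6,3,2,0,5,7,4,9]) (Cite 1
     [2,6,4,3,5,9,0,1]))))),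
   (16, ([0,1,2,3,4,5,6,7,8,9], [(0,8),(1,4),(1,5)], []), Split 4 8 (Split 3 8 (Cite 5
     [0,1,2,3,4,5,6,7,8,9]) (Cite 8 [0,1,2,3,4,5,6,7,8,9])) (Split 5 8 (Split 1 2 (Cite 5
     [2,8,3,4,5,0,6,7,1,9]) (Cite 8 [4,8,3,2,5,0,6,7,1,9])) (Split 0 4 (Split 1 9 (Cite 5
     [9,0,2,5,4,8,3,6,1,7]) (Cite 8 [5,0,2,9,4,8,3,6,1,7])) (Split 0 5 (Split 0 7 (Cite 5
     [7,1,2,8,5,4,3,6,0,9]) (Cite 8 [8,1,2,7,5,4,3,6,0,9])) (Split 2 4 (Cite 9
     [0,1,2,3,4,5,6,7,8,9]) (Split 3 5 (Cite 9 [0,1,3,2,5,4,6,7,8,9]) (Split 3 4 (Cite 9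
     [0,1,3,2,4,5,6,7,8,9]) (Split 2 5 (Cite 9 [0,1,2,3,5,4,6,7,8,9]) (Split 4 9 (Cite 9
     [0,1,9,2,4,5,3,6,8,7]) (Split 5 9 (Cite 9 [0,1,9,2,5,4,3,6,8,7]) (Split 4 6 (Cite 9
     [0,1,6,2,4,5,3,7,8,9]) (Split 5 7 (Cite 9 [0,1,7,2,5,4,3,6,8,9]) (Split 5 6 (Cite 9
     [0,1,6,2,5,4,3,7,8,9]) (Split 2 8 (Cite 10 [0,1,2,3,4,5,6,7,8,9]) (Split 0 3 (Cite 10
     [3,1,8,2,4,5,6,9,0,7]) (Split 8 9 (Cite 10 [9,1,0,2,4,5,3,7,8,6]) (Split 0 9 (Cite 10
     [9,1,8,2,4,5,3,7,0,6]) (Cite 1 [0,9,8,2,4,6,5,3])))))))))))))))))),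
   (17, ([0,1,2,3,4,5,6,7,8,9], [(0,8),(1,5)], [(1,4)]), Split 8 9 (Cite 16 [1,8,2,3,9,0,4,6,5,7])
     (Split 5 6 (Cite 16 [0,5,2,3,6,1,4,7,8,9]) (Split 0 7 (Cite 16 [1,0,2,3,7,8,4,6,5,9]) (Split
     5 7 (Cite 16 [0,5,2,3,7,1,4,6,8,9]) (Split 1 6 (Cite 16 [0,1,2,3,6,5,4,7,8,9]) (Split 4 8
     (Cite 16 [1,8,2,3,4,0,6,7,5,9]) (Split 0 9 (Cite 16 [1,0,2,3,9,8,4,6,5,7]) (Cite 1
     [0,9,8,4,1,6,5,7])))))))),
   (19, ([0,1,2,3,4,5,6,7,8,9], [(1,5)], []), Split 0 8 (Split 1 4 (Cite 16 [0,1,2,3,4,5,6,7,8,9])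
     (Cite 17 [0,1,2,3,4,5,6,7,8,9])) (Split 0 2 (Cite 17 [1,0,3,4,8,2,6,7,5,9]) (Split 0 4 (Cite
     17 [1,0,3,6,2,4,7,8,5,9]) (Split 4 9 (Cite 17 [1,4,2,3,0,9,6,7,5,8]) (Split 0 3 (Cite 17
     [1,0,4,6,2,3,7,8,5,9]) (Split 3 6 (Cite 17 [1,3,2,4,0,6,7,8,5,9]) (Split 0 9 (Cite 17
     [1,0,3,4,2,9,6,7,5,8]) (Split 2 4 (Cite 17 [1,2,3,6,0,4,7,8,5,9]) (Split 3 8 (Cite 17
     [1,3,2,4,0,8,6,7,5,9]) (Split 7 9 (Cite 17 [1,9,2,3,0,7,4,6,5,8]) (Split 6 7 (Cite 17
     [1,6,0,2,3,7,4,8,5,9]) (Cite 1 [6,7,9,4,2,0,8,3])))))))))))),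
   (21, ([0,1,2,3,4,5,6,7,8,9], [], []), Split 1 5 (Cite 19 [0,1,2,3,4,5,6,7,8,9]) (Split 4 8
     (Cite 19 [0,4,1,2,3,8,5,6,7,9]) (Split 6 8 (Cite 19 [0,6,1,2,3,8,4,5,7,9]) (Split 2 7 (Cite
     19 [0,2,1,3,4,7,5,6,8,9]) (Split 3 5 (Cite 19 [0,3,1,2,4,5,6,7,8,9]) (Split 1 7 (Cite 19
     [0,1,2,3,4,7,5,6,8,9]) (Split 3 6 (Cite 19 [0,3,1,2,4,6,5,7,8,9]) (Split 2 4 (Cite 19
     [0,2,1,3,5,4,6,7,8,9]) (Cite 1 [2,4,8,6,3,5,1,7])))))))))]"

lemma check_ramsey_cert_B:
  "check_all 0 0 [(0, tree_pattern edges_B), (1, cycle_pattern)] ([0,1,2,3,4,5,6,7,8,9], [], [])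
     ramsey_cert_B"
  by code_simp

text \<open>As for A, numbers 13 and 21 exclude K_4 and K_4 minus an edge. With number 24 for a
  pendant vertex not joined to \<open>2\<close>, triangles disappear. Number 25 is a pair of
  4-cycles sharing an edge.\<close>

definition degree_cert_B :: "(nat \<times> pattern \<times> cert) list" where
  "degree_cert_B =
   [(1, ([0,1,2,3,4,5], [(0,1),(0,2),(0,3),(1,2),(1,3),(2,3),(2,4),(2,5),(3,4),(3,5),(4,5)], []),
     Exit 6 [(0, Cite 0 [1,2,0,3,4,5,6]), (1, Cite 0 [0,2,1,3,4,5,6]), (2, Cite 0
     [0,1,2,3,4,5,6]), (3, Cite 0 [0,1,2,4,3,6,5]), (4, Cite 0 [0,1,2,3,4,6,5]), (5, Cite 0
     [0,1,2,3,5,6,4])]),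
   (5, ([0,1,2,3,4,5], [(0,3),(0,4),(1,2),(1,3),(1,4),(1,5),(2,3),(2,4),(2,5)], []), Exit 6 [(0,
     Cite 0 [1,3,0,4,2,5,6]), (1, Cite 0 [0,3,1,4,2,5,6]), (2, Cite 0 [0,3,1,4,2,6,5]), (3, Cite 0
     [0,4,1,2,3,6,5]), (4, Cite 0 [0,3,1,2,4,6,5]), (5, Cite 0 [0,3,1,2,5,6,4])]),
   (6, ([0,1,2,3,4,5], [(0,1),(0,2),(0,3),(0,4),(0,5),(1,2),(1,3),(1,4),(2,3),(2,4)], [(1,5)]),
     Split 3 5 (Cite 5 [5,1,2,3,0,4]) (Split 4 5 (Cite 5 [5,1,2,4,0,3]) (Split 2 5 (Cite 5
     [1,2,0,3,4,5]) (Nbr 5 6 (Cite 0 [1,3,2,0,5,6,4]))))),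
   (7, ([0,1,2,3,4,5], [(0,1),(0,2),(0,3),(0,4),(1,2),(1,3),(1,4),(2,3),(2,4),(3,5)], []), Split 1
     5 (Cite 5 [5,0,2,1,3,4]) (Split 0 5 (Cite 5 [5,1,2,0,3,4]) (Split 2 5 (Cite 5 [5,0,1,2,3,4])
     (Split 4 5 (Cite 5 [5,0,1,4,3,2]) (Nbr 5 6 (Cite 0 [0,1,2,3,5,6,4])))))),
   (8, ([0,1,2,3,4], [(0,1),(0,2),(0,3),(0,4),(1,2),(1,3),(1,4),(2,3),(2,4)], []), Exit 5 [(0,
     Split 1 5 (Cite 5 [2,0,1,3,4,5]) (Cite 6 [0,1,2,3,4,5])), (1, Split 0 5 (Cite 5
     [2,0,1,3,4,5]) (Cite 6 [1,0,2,3,4,5])), (2, Split 0 5 (Cite 5 [1,0,2,3,4,5]) (Cite 6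
     [2,0,1,3,4,5])), (3, Cite 7 [0,1,2,3,4,5]), (4, Cite 7 [0,1,2,4,3,5])]),
   (9, ([0,1,2,3,4,5], [(0,1),(0,2),(0,3),(0,4),(1,2),(1,3),(2,3),(2,4),(4,5)], []), Split 3 5
     (Cite 5 [5,0,2,3,4,1]) (Split 1 5 (Cite 5 [5,0,2,1,4,3]) (Split 2 5 (Split 0 5 (Cite 1
     [5,4,0,2,1,3]) (Nbr 5 6 (Cite 0 [0,1,2,4,5,6,3]))) (Nbr 5 6 (Cite 0 [0,1,2,4,5,6,3]))))),
   (12, ([0,1,2,3,4], [(0,1),(0,2),(0,3),(0,4),(1,2),(1,3),(2,3)], []), Split 2 4 (Split 1 4 (Cite
     8 [0,1,2,3,4]) (Split 3 4 (Cite 8 [3,0,2,4,1]) (Nbr 4 5 (Cite 9 [0,1,2,3,4,5])))) (Split 3 4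
     (Split 1 4 (Cite 8 [1,0,3,4,2]) (Nbr 4 5 (Cite 9 [0,1,3,2,4,5]))) (Nbr 4 5 (Split 1 4 (Cite 9
     [1,2,0,3,4,5]) (Nbr 4 6 (Split 3 5 (Cite 0 [3,5,4,0,1,2,6]) (Split 0 5 (Cite 0
     [2,1,0,5,4,6,3]) (Split 2 5 (Cite 0 [2,5,4,0,1,3,6]) (Split 1 5 (Cite 0 [1,5,4,0,2,3,6])
     (Split 5 6 (Cite 0 [2,1,0,4,5,6,3]) (Nbr 5 7 (Cite 0 [1,2,0,4,5,7,3])))))))))))),
   (13, ([0,1,2,3], [(0,1),(0,2),(0,3),(1,2),(1,3),(2,3)], []), Exit 4 [(0, Cite 12 [0,1,2,3,4]),
     (1, Cite 12 [1,0,2,3,4]), (2, Cite 12 [2,0,1,3,4]), (3, Cite 12 [3,0,1,2,4])]),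
   (15, ([0,1,2,3,4,5], [(0,1),(0,2),(0,3),(1,2),(1,4),(1,5),(2,3),(2,5),(3,4),(3,5),(4,5)], []),
     Exit 6 [(0, Cite 0 [1,2,0,3,4,5,6]), (1, Cite 0 [0,2,1,4,3,5,6]), (2, Cite 0
     [0,1,2,3,4,5,6]), (3, Cite 0 [0,1,5,2,3,6,4]), (4, Cite 0 [0,1,2,3,4,6,5]), (5, Cite 0
     [0,1,5,2,3,4,6])]),
   (16, ([0,1,2,3,4,5], [(0,1),(0,2),(0,3),(0,4),(1,2),(1,4),(1,5),(2,3),(3,4)], []), Split 0 5
     (Cite 5 [3,0,1,2,4,5]) (Split 4 5 (Split 3 5 (Cite 15 [2,1,0,3,5,4]) (Split 2 5 (Cite 15
     [5,2,1,4,3,0]) (Nbr 5 6 (Cite 0 [0,1,5,4,3,2,6])))) (Split 2 5 (Split 3 5 (Cite 15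
     [5,3,2,1,4,0]) (Nbr 5 6 (Cite 0 [0,1,5,2,3,4,6]))) (Nbr 5 6 (Cite 0 [2,0,4,1,5,6,3]))))),
   (18, ([0,1,2,3,4,5], [(0,1),(0,2),(0,3),(1,2),(1,4),(2,3),(3,5),(4,5)], []), Exit 6 [(0, Cite 0
     [1,2,0,3,5,4,6]), (1, Cite 0 [0,2,1,4,5,3,6]), (2, Cite 0 [0,1,2,3,5,4,6]), (3, Cite 0
     [0,2,3,5,4,1,6]), (4, Cite 0 [0,1,4,5,3,2,6]), (5, Cite 0 [0,3,5,4,1,2,6])]),
   (19, ([0,1,2,3,4], [(0,1),(0,2),(0,3),(0,4),(1,2),(1,4),(2,3)], [(1,3)]), Split 2 4 (Cite 13
     [2,4,0,1]) (Split 3 4 (Exit 5 [(0, Split 1 5 (Cite 5 [3,1,0,2,4,5]) (Split 4 5 (Cite 5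
     [2,4,0,1,3,5]) (Split 3 5 (Cite 5 [1,3,0,2,4,5]) (Split 2 5 (Cite 5 [4,2,0,1,3,5]) (Nbr 5 6
     (Cite 0 [1,2,3,0,5,6,4])))))), (1, Cite 16 [0,1,2,3,4,5]), (2, Cite 16 [0,2,1,4,3,5]), (3,
     Cite 16 [0,3,2,1,4,5]), (4, Cite 16 [0,4,1,2,3,5])]) (Nbr 3 5 (Split 4 5 (Cite 18
     [0,1,2,3,4,5]) (Nbr 4 6 (Cite 0 [1,2,3,0,4,6,5])))))),
   (21, ([0,1,2,3], [(0,1),(0,2),(0,3),(1,2),(2,3)], []), Split 1 3 (Cite 13 [0,1,2,3]) (Nbr 1 4
     (Split 0 4 (Cite 19 [0,1,2,3,4]) (Split 2 4 (Cite 19 [2,0,1,4,3]) (Nbr 4 5 (Split 3 5 (Cite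
     18 [0,3,2,1,5,4]) (Split 1 5 (Split 3 4 (Cite 18 [0,3,2,1,4,5]) (Nbr 4 6 (Cite 0
     [3,0,1,5,4,6,2]))) (Split 0 5 (Split 2 5 (Cite 5 [4,2,0,5,1,3]) (Nbr 5 6 (Cite 0
     [1,4,5,0,2,3,6]))) (Nbr 5 6 (Cite 0 [3,0,1,4,5,6,2])))))))))),
   (24, ([0,1,2,3], [(0,1),(0,2),(0,3),(2,3)], [(1,2)]), Split 1 3 (Cite 21 [3,1,0,2]) (Nbr 3 4
     (Split 0 4 (Cite 21 [0,4,3,2]) (Split 2 4 (Cite 21 [2,4,3,0]) (Nbr 2 5 (Split 4 5 (Split 1 5
     (Split 1 4 (Exit 6 [(0, Cite 0 [2,3,0,1,4,5,6]), (1, Cite 0 [2,0,1,5,4,3,6]), (2, Cite 0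
     [0,1,4,3,2,6,5]), (3, Cite 0 [0,1,5,2,3,6,4]), (4, Cite 0 [0,1,4,3,2,5,6]), (5, Cite 0
     [0,1,5,2,3,4,6])]) (Nbr 4 6 (Cite 0 [1,0,2,3,4,6,5]))) (Nbr 1 6 (Cite 0 [4,3,2,0,1,6,5])))
     (Nbr 4 6 (Cite 0 [1,0,2,3,4,6,5])))))))),
   (25, ([0,1,2,3,4,5], [(0,1),(0,2),(1,3),(2,3),(2,5),(3,4),(4,5)], []), Exit 6 [(0, Cite 0
     [3,1,0,2,5,4,6]), (1, Cite 0 [2,0,1,3,4,5,6]), (2, Cite 0 [1,0,2,3,4,5,6]), (3, Cite 0
     [0,1,3,2,5,4,6]), (4, Cite 0 [1,0,2,3,4,6,5]), (5, Cite 0 [0,1,3,2,5,6,4])]),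
   (29, ([0], [], []), Nbr 0 1 (Nbr 0 2 (Nbr 2 3 (Split 0 3 (Split 1 2 (Cite 21 [0,1,2,3]) (Cite
     24 [0,1,2,3])) (Split 1 2 (Cite 24 [2,3,0,1]) (Nbr 3 4 (Split 2 4 (Cite 24 [2,0,3,4]) (Nbr 2
     5 (Split 3 5 (Cite 24 [3,4,2,5]) (Split 0 5 (Cite 24 [0,1,2,5]) (Split 1 4 (Split 1 3 (Cite
     24 [1,0,3,4]) (Nbr 3 6 (Cite 0 [5,2,3,4,1,0,6]))) (Split 1 3 (Split 1 5 (Split 0 4 (Cite 25
     [0,4,1,3,2,5]) (Nbr 0 6 (Cite 0 [5,1,0,2,3,4,6]))) (Nbr 1 6 (Cite 0 [4,3,1,0,2,5,6]))) (Nbr 1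
     6 (Cite 0 [4,3,2,0,1,6,5]))))))))))))))]"

lemma check_degree_cert_B:
  "check_all 3 6 [(0, tree_pattern edges_B)] ([0], [], []) degree_cert_B"
  by code_simp

section \<open>Case distinctions for the tree C\<close>

definition edges_C :: edges where
  "edges_C = [(1,2), (2,3), (3,4), (4,5), (2,6), (3,7)]"

text \<open>Number 5 is C without its leaf 1, number 16 a path on three vertices with a disjoint
  edge, and number 19 two disjoint edges.\<close>

definition ramsey_cert_C :: "(nat \<times> pattern \<times> cert) list" where
  "ramsey_cert_C =
   [(2, ([0,1,2,3,4,5,6,7,8,9], [(0,1),(1,7),(1,9),(2,7),(7,8),(8,9)], [(4,7),(5,9),(6,7),(6,9)]),
     Split 2 3 (Cite 0 [0,1,7,2,3,9,8]) (Split 1 5 (Cite 0 [5,1,7,8,9,0,2]) (Split 2 4 (Cite 0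
     [0,1,7,2,4,9,8]) (Split 1 3 (Cite 0 [3,1,7,8,9,0,2]) (Cite 1 [1,3,2,4,7,6,9,5]))))),
   (3, ([0,1,2,3,4,5,6,7,8,9], [(0,1),(1,2),(1,9),(2,7),(8,9)],
     [(3,7),(3,9),(4,7),(4,9),(5,7),(5,9),(6,7),(6,9)]), Split 2 5 (Cite 0 [5,2,1,9,8,7,0]) (Split
     2 6 (Cite 0 [6,2,1,9,8,7,0]) (Split 2 8 (Cite 2 [0,1,7,4,6,3,5,2,8,9]) (Split 2 4 (Cite 0
     [4,2,1,9,8,7,0]) (Split 2 3 (Cite 0 [3,2,1,9,8,7,0]) (Split 0 4 (Split 0 3 (Cite 0
     [3,0,1,2,7,4,9]) (Split 0 8 (Cite 0 [8,0,1,2,7,4,9]) (Cite 1 [0,8,2,4,7,5,9,3]))) (Split 0 8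
     (Split 0 3 (Cite 0 [3,0,1,2,7,8,9]) (Cite 1 [0,3,2,5,7,6,9,4])) (Cite 1
     [0,8,2,3,7,5,9,4])))))))),
   (5, ([0,1,2,3,4,5,6,7,8,9], [(0,1),(1,7),(1,9),(2,7),(8,9)], []), Split 5 9 (Cite 0
     [5,9,1,7,2,8,0]) (Split 4 7 (Cite 0 [4,7,1,9,8,2,0]) (Split 5 7 (Cite 0 [5,7,1,9,8,2,0])
     (Split 4 9 (Cite 0 [4,9,1,7,2,8,0]) (Split 3 9 (Cite 0 [3,9,1,7,2,8,0]) (Split 3 7 (Cite 0
     [3,7,1,9,8,2,0]) (Split 6 9 (Cite 0 [6,9,1,7,2,8,0]) (Split 6 7 (Cite 0 [6,7,1,9,8,2,0])
     (Split 7 8 (Cite 2 [0,1,2,3,4,5,6,7,8,9]) (Split 2 9 (Cite 2 [0,1,8,6,4,5,3,9,2,7]) (Split 1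
     2 (Cite 3 [0,1,2,3,4,5,6,7,8,9]) (Split 1 8 (Cite 3 [0,1,8,3,4,5,6,9,2,7]) (Split 0 8 (Split
     0 4 (Cite 0 [4,0,1,7,2,8,9]) (Split 0 5 (Cite 0 [5,0,1,7,2,8,9]) (Cite 1 [0,5,7,8,1,2,9,4])))
     (Split 0 4 (Split 0 3 (Cite 0 [3,0,1,7,2,4,9]) (Cite 1 [0,3,7,4,9,2,1,8])) (Cite 1
     [0,4,7,3,9,2,1,8]))))))))))))))),
   (6, ([0,1,2,3,4,5,6,7,8,9], [(0,1),(1,7),(2,7),(6,7)], [(1,8),(1,9),(7,8),(7,9)]), Split 3 6
     (Cite 5 [2,7,3,4,5,8,9,6,0,1]) (Split 6 8 (Cite 5 [2,7,8,3,4,5,9,6,0,1]) (Split 2 5 (Cite 5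
     [6,7,5,3,4,8,9,2,0,1]) (Split 2 4 (Cite 5 [6,7,4,3,5,8,9,2,0,1]) (Split 2 3 (Cite 5
     [6,7,3,4,5,8,9,2,0,1]) (Split 1 4 (Split 0 5 (Cite 5 [4,1,5,3,6,8,9,0,2,7]) (Split 0 9 (Cite
     5 [4,1,9,3,5,6,8,0,2,7]) (Cite 1 [0,9,1,8,6,3,2,5]))) (Cite 1 [1,4,2,3,6,8,7,9]))))))),
   (7, ([0,1,2,3,4,5,6,7,8,9], [(0,1),(0,8),(1,7),(2,7),(8,9)], [(1,4),(1,5),(3,7),(5,7),(7,8)]),
     Split 0 4 (Cite 5 [4,0,7,2,3,5,6,1,9,8]) (Split 0 7 (Cite 5 [1,0,2,3,4,5,6,7,9,8]) (Split 0 2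
     (Cite 5 [2,0,7,3,4,5,6,1,9,8]) (Split 2 8 (Cite 5 [9,8,7,3,4,5,6,2,1,0]) (Split 3 8 (Cite 6
     [1,0,3,4,5,6,9,8,2,7]) (Cite 1 [3,8,2,0,4,1,5,7])))))),
   (10, ([0,1,2,3,4,5,6,7,8,9], [(0,1),(1,7),(2,7),(8,9)], [(1,9)]), Split 1 8 (Cite 5
     [0,1,9,3,4,5,6,8,2,7]) (Split 7 9 (Cite 5 [2,7,8,3,4,5,6,9,0,1]) (Split 7 8 (Cite 5
     [2,7,9,3,4,5,6,8,0,1]) (Split 6 7 (Cite 6 [0,1,2,3,4,5,6,7,8,9]) (Split 1 4 (Cite 6
     [2,7,4,3,5,6,0,1,8,9]) (Split 1 6 (Cite 6 [2,7,6,3,4,5,0,1,8,9]) (Split 1 5 (Cite 6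
     [2,7,5,3,4,9,0,1,6,8]) (Split 4 7 (Cite 6 [0,1,4,3,5,9,2,7,6,8]) (Split 3 7 (Cite 6
     [0,1,3,5,8,9,2,7,4,6]) (Split 5 7 (Cite 6 [0,1,5,3,8,9,2,7,4,6]) (Split 1 3 (Cite 6
     [2,7,3,6,8,9,0,1,4,5]) (Split 0 8 (Cite 7 [0,1,2,3,4,5,6,7,8,9]) (Split 0 9 (Cite 7
     [0,1,2,4,5,3,6,7,9,8]) (Split 2 8 (Cite 7 [2,7,0,4,5,3,6,1,8,9]) (Split 2 9 (Cite 7
     [2,7,0,4,5,3,6,1,9,8]) (Split 0 6 (Split 0 4 (Cite 6 [7,1,4,2,3,5,6,0,8,9]) (Cite 1
     [0,4,1,3,7,8,2,9])) (Cite 1 [0,6,1,3,7,8,2,9]))))))))))))))))),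
   (11, ([0,1,2,3,4,5,6,7,8,9], [(1,7),(1,8),(2,7),(8,9)], [(0,1)]), Split 1 6 (Cite 5
     [6,1,2,0,3,4,5,7,9,8]) (Split 1 5 (Cite 5 [5,1,2,0,3,4,6,7,9,8]) (Split 6 9 (Cite 10
     [8,1,2,0,3,4,5,7,9,6]) (Split 0 3 (Cite 10 [8,1,2,4,5,6,9,7,3,0]) (Split 4 6 (Cite 10
     [8,1,2,0,3,5,9,7,4,6]) (Split 5 9 (Cite 10 [8,1,2,0,3,4,6,7,9,5]) (Split 2 5 (Cite 10
     [7,1,9,0,3,4,6,8,2,5]) (Split 1 3 (Cite 5 [3,1,2,0,4,5,6,7,9,8]) (Split 1 4 (Cite 5
     [4,1,2,0,3,5,6,7,9,8]) (Split 0 2 (Cite 10 [7,1,9,3,4,5,6,8,2,0]) (Cite 1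
     [0,2,5,9,6,4,1,3]))))))))))),
   (12, ([0,1,2,3,4,5,6,7,8,9], [(1,7),(4,5),(8,9)], [(0,1),(0,2),(1,4),(1,5),(1,8),(2,4)]), Split
     5 9 (Cite 10 [4,5,8,0,2,3,6,9,7,1]) (Split 7 9 (Cite 10 [8,9,1,0,2,3,6,7,4,5]) (Split 5 7
     (Cite 10 [4,5,1,0,2,3,6,7,8,9]) (Split 5 8 (Cite 10 [4,5,9,0,2,3,6,8,7,1]) (Split 4 9 (Cite
     10 [5,4,8,0,2,3,6,9,7,1]) (Cite 1 [4,9,7,5,8,1,0,2])))))),
   (16, ([0,1,2,3,4,5,6,7,8,9], [(1,7),(2,7),(8,9)], []), Split 0 1 (Split 1 9 (Cite 5
     [0,1,2,3,4,5,6,7,8,9]) (Cite 10 [0,1,2,3,4,5,6,7,8,9])) (Split 1 8 (Cite 11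
     [0,1,2,3,4,5,6,7,8,9]) (Split 1 3 (Cite 10 [3,1,2,0,4,5,6,7,9,8]) (Split 1 6 (Cite 10
     [6,1,2,0,3,4,5,7,9,8]) (Split 1 4 (Cite 10 [4,1,2,0,3,5,6,7,9,8]) (Split 1 5 (Cite 10
     [5,1,2,0,3,4,6,7,9,8]) (Split 2 9 (Split 2 5 (Cite 5 [5,2,1,0,3,4,6,7,8,9]) (Cite 11
     [5,2,1,0,3,4,6,7,9,8])) (Split 2 6 (Cite 10 [6,2,1,0,3,4,5,7,8,9]) (Split 2 8 (Cite 11
     [6,2,9,0,3,4,5,8,7,1]) (Split 2 3 (Cite 10 [3,2,1,0,4,5,6,7,9,8]) (Split 2 4 (Cite 10
     [4,2,1,0,3,5,6,7,9,8]) (Split 0 2 (Cite 10 [0,2,1,3,4,5,6,7,9,8]) (Split 4 5 (Cite 12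
     [0,1,2,3,4,5,6,7,8,9]) (Split 0 5 (Cite 12 [3,1,2,4,0,5,6,7,8,9]) (Split 4 6 (Cite 12
     [0,1,2,3,4,6,5,7,8,9]) (Split 3 6 (Cite 12 [0,1,2,4,3,6,5,7,8,9]) (Cite 1
     [3,6,4,5,0,1,8,2]))))))))))))))))),
   (19, ([0,1,2,3,4,5,6,7,8,9], [(1,9),(2,7)], []), Split 1 5 (Cite 16 [0,5,9,3,4,6,8,1,2,7])
     (Split 2 4 (Cite 16 [0,4,7,3,5,6,8,2,1,9]) (Split 7 8 (Cite 16 [0,8,2,3,4,5,6,7,1,9]) (Split
     8 9 (Cite 16 [0,8,1,3,4,5,6,9,2,7]) (Split 0 1 (Cite 16 [3,0,9,4,5,6,8,1,2,7]) (Split 0 9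
     (Cite 16 [3,0,1,4,5,6,8,9,2,7]) (Split 2 5 (Cite 16 [0,5,7,3,4,6,8,2,1,9]) (Split 4 7 (Cite
     16 [0,4,2,3,5,6,8,7,1,9]) (Cite 1 [4,7,8,9,0,1,5,2]))))))))),
   (20, ([0,1,2,3,4,5,6,7,8,9], [(2,7)], [(1,9)]), Split 4 6 (Cite 19 [0,4,2,1,3,5,8,7,9,6])
     (Split 0 8 (Cite 19 [1,0,2,3,4,5,6,7,9,8]) (Split 1 5 (Cite 19 [0,1,2,3,4,6,8,7,9,5]) (Split
     0 5 (Cite 19 [1,0,2,3,4,6,8,7,9,5]) (Split 3 9 (Cite 19 [0,3,2,1,4,5,6,7,8,9]) (Split 4 8
     (Cite 19 [0,4,2,1,3,5,6,7,9,8]) (Split 3 6 (Cite 19 [0,3,2,1,4,5,8,7,9,6]) (Cite 1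
     [3,6,4,8,0,5,1,9])))))))),
   (22, ([0,1,2,3,4,5,6,7,8,9], [], []), Split 2 7 (Split 1 9 (Cite 19 [0,1,2,3,4,5,6,7,8,9])
     (Cite 20 [0,1,2,3,4,5,6,7,8,9])) (Split 4 5 (Cite 20 [0,2,4,1,3,6,8,5,9,7]) (Split 8 9 (Cite
     20 [0,2,8,1,3,4,5,9,6,7]) (Split 6 7 (Cite 20 [0,4,6,1,2,3,8,7,9,5]) (Split 6 8 (Cite 20
     [0,2,6,1,3,4,5,8,9,7]) (Split 0 3 (Cite 20 [1,2,0,4,5,6,8,3,9,7]) (Split 4 9 (Cite 20
     [1,0,4,2,5,6,7,9,8,3]) (Split 0 4 (Cite 20 [1,2,0,3,5,6,8,4,9,7]) (Split 2 3 (Cite 20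
     [1,0,2,5,6,7,8,3,9,4]) (Cite 1 [2,3,0,4,9,8,6,7]))))))))))]"

lemma check_ramsey_cert_C:
  "check_all 0 0 [(0, tree_pattern edges_C), (1, cycle_pattern)] ([0,1,2,3,4,5,6,7,8,9], [], [])
     ramsey_cert_C"
  by code_simp

text \<open>Number 9 is K_4 with a pendant edge, number 11 the wheel \<open>W_4\<close>, and number
  17 is K_4 minus an edge; the case of a full K_4 is settled inside number 17 by
  \<open>Exit\<close>.\<close>

definition degree_cert_C :: "(nat \<times> pattern \<times> cert) list" where
  "degree_cert_C =
   [(1, ([0,1,2,3,4,5], [(0,1),(0,2),(1,2),(1,3),(1,4),(1,5),(2,3),(2,4),(2,5),(3,4)], []), Exit 6
     [(0, Cite 0 [1,0,2,3,4,6,5]), (1, Cite 0 [0,1,2,3,4,6,5]), (2, Cite 0 [0,1,2,3,4,5,6]), (3,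
     Cite 0 [0,1,2,3,6,4,5]), (4, Cite 0 [0,1,2,4,6,3,5]), (5, Cite 0 [0,1,2,5,6,3,4])]),
   (4, ([0,1,2,3,4,5], [(0,1),(0,2),(1,2),(1,3),(1,4),(2,3),(2,5),(3,4),(4,5)], []), Exit 6 [(0,
     Cite 0 [1,0,2,3,4,6,5]), (1, Cite 0 [0,1,2,3,4,6,5]), (2, Cite 0 [0,1,2,5,4,3,6]), (3, Cite 0
     [0,1,2,3,6,4,5]), (4, Cite 0 [0,1,4,5,2,3,6]), (5, Cite 0 [0,1,2,5,6,4,3])]),
   (5, ([0,1,2,3,4,5], [(0,1),(0,2),(0,3),(0,4),(0,5),(1,2),(1,3),(1,4),(2,3),(3,4)], []), Split 3
     5 (Cite 4 [5,3,0,2,1,4]) (Split 1 5 (Cite 4 [5,1,0,2,3,4]) (Split 2 5 (Cite 4 [4,1,0,3,2,5])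
     (Split 4 5 (Cite 4 [5,4,0,1,3,2]) (Nbr 5 6 (Cite 0 [1,2,0,5,6,3,4])))))),
   (6, ([0,1,2,3,4,5], [(0,1),(0,2),(0,3),(0,4),(1,2),(1,4),(2,3),(2,5),(3,4)], []), Split 1 5
     (Cite 4 [5,1,2,0,4,3]) (Split 3 5 (Cite 4 [5,3,2,0,4,1]) (Split 0 5 (Cite 4 [5,0,2,1,4,3])
     (Split 4 5 (Cite 4 [3,0,4,1,2,5]) (Nbr 5 6 (Cite 0 [0,1,2,5,6,4,3])))))),
   (7, ([0,1,2,3,4], [(0,1),(0,2),(0,3),(0,4),(1,2),(1,3),(1,4),(2,3),(3,4)], []), Exit 5 [(0,
     Cite 5 [0,1,2,3,4,5]), (1, Cite 5 [1,0,2,3,4,5]), (2, Cite 6 [0,1,2,3,4,5]), (3, Cite 6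
     [0,2,3,4,1,5]), (4, Cite 6 [0,1,4,3,2,5])]),
   (8, ([0,1,2,3,4,5], [(0,1),(0,2),(0,3),(0,4),(1,2),(1,3),(2,3),(3,4),(4,5)], []), Split 1 5
     (Cite 4 [2,0,1,3,4,5]) (Split 2 5 (Cite 4 [1,0,2,3,4,5]) (Split 3 5 (Split 0 5 (Cite 1
     [5,0,3,1,2,4]) (Nbr 5 6 (Cite 0 [0,1,3,5,6,2,4]))) (Nbr 5 6 (Cite 0 [1,0,4,5,6,2,3]))))),
   (9, ([0,1,2,3,4], [(0,1),(0,2),(0,3),(0,4),(1,2),(1,3),(2,3)], []), Split 3 4 (Split 1 4 (Cite
     7 [0,1,2,3,4]) (Split 2 4 (Cite 7 [2,0,4,3,1]) (Nbr 4 5 (Cite 8 [0,1,2,3,4,5])))) (Split 1 4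
     (Split 2 4 (Cite 7 [2,0,4,1,3]) (Nbr 4 5 (Cite 8 [0,2,3,1,4,5]))) (Nbr 4 5 (Split 2 4 (Cite 8
     [2,1,3,0,4,5]) (Nbr 4 6 (Cite 0 [5,4,0,1,2,6,3])))))),
   (11, ([0,1,2,3,4], [(0,1),(0,2),(0,3),(0,4),(1,2),(1,4),(2,3),(3,4)], []), Exit 5 [(0, Split 4
     5 (Cite 4 [5,0,4,1,2,3]) (Split 1 5 (Cite 4 [5,0,1,2,3,4]) (Split 3 5 (Cite 4 [5,0,3,2,1,4])
     (Split 2 5 (Cite 4 [5,0,2,1,4,3]) (Nbr 5 6 (Cite 0 [1,2,0,5,6,3,4])))))), (1, Cite 6
     [0,2,1,4,3,5]), (2, Cite 6 [0,1,2,3,4,5]), (3, Cite 6 [0,2,3,4,1,5]), (4, Cite 6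
     [0,1,4,3,2,5])]),
   (12, ([0,1,2,3,4,5], [(0,1),(0,2),(0,3),(1,2),(1,4),(2,3),(3,5),(4,5)], []), Exit 6 [(0, Cite 0
     [1,0,3,5,4,6,2]), (1, Cite 0 [0,2,1,4,5,3,6]), (2, Cite 0 [0,1,2,3,5,4,6]), (3, Cite 0
     [0,2,3,5,4,1,6]), (4, Cite 0 [0,1,4,5,3,2,6]), (5, Cite 0 [0,3,5,4,1,2,6])]),
   (17, ([0,1,2,3], [(0,1),(0,2),(0,3),(1,2),(2,3)], []), Split 1 3 (Exit 4 [(0, Cite 9
     [0,1,2,3,4]), (1, Cite 9 [1,0,2,3,4]), (2, Cite 9 [2,0,1,3,4]), (3, Cite 9 [3,0,1,2,4])])
     (Nbr 1 4 (Split 0 4 (Split 2 4 (Cite 9 [2,4,0,1,3]) (Split 3 4 (Cite 11 [0,1,2,3,4]) (Nbr 3 5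
     (Split 4 5 (Cite 12 [0,1,2,3,4,5]) (Nbr 4 6 (Cite 0 [1,4,0,3,5,6,2])))))) (Split 3 4 (Split 2
     4 (Cite 11 [2,4,1,0,3]) (Nbr 4 5 (Split 1 5 (Cite 12 [0,1,2,3,5,4]) (Split 3 5 (Cite 12
     [0,3,2,1,5,4]) (Split 2 5 (Split 0 5 (Exit 6 [(0, Cite 0 [1,0,2,3,4,6,5]), (1, Cite 0
     [0,1,2,3,4,6,5]), (2, Cite 0 [1,0,2,3,4,5,6]), (3, Cite 0 [0,1,2,3,6,4,5]), (4, Cite 0
     [1,0,3,4,6,5,2]), (5, Cite 0 [0,1,2,5,6,4,3])]) (Nbr 5 6 (Cite 0 [0,1,2,5,6,4,3]))) (Nbr 5 6
     (Cite 0 [0,1,4,5,6,2,3]))))))) (Nbr 3 5 (Split 4 5 (Cite 12 [0,1,2,3,4,5]) (Nbr 4 6 (Split 2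
     4 (Cite 0 [1,4,2,3,5,6,0]) (Nbr 4 7 (Cite 0 [6,4,1,0,3,7,2])))))))))),
   (18, ([0,1,2,3,4,5], [(0,1),(0,3),(1,2),(1,4),(2,5),(3,4),(3,5),(4,5)], []), Exit 6 [(0, Cite 0
     [1,0,3,5,2,6,4]), (1, Cite 0 [0,1,4,5,2,6,3]), (2, Cite 0 [0,1,2,5,3,4,6]), (3, Cite 0
     [0,1,4,3,6,2,5]), (4, Cite 0 [0,1,4,3,5,2,6]), (5, Cite 0 [0,1,4,5,6,2,3])]),
   (19, ([0,1,2,3,4], [(0,1),(0,2),(0,3),(1,2),(1,4)], [(1,3),(2,3)]), Split 2 4 (Cite 17
     [2,4,1,0]) (Nbr 2 5 (Split 3 5 (Split 3 4 (Cite 18 [4,3,5,1,0,2]) (Nbr 3 6 (Cite 0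
     [5,3,0,1,4,6,2]))) (Nbr 3 6 (Split 3 4 (Cite 0 [4,3,0,2,5,6,1]) (Nbr 3 7 (Cite 0
     [6,3,0,1,4,7,2]))))))),
   (20, ([0,1,2,3,4,5], [(0,1),(0,2),(0,3),(1,4),(1,5),(4,5)], [(0,4),(0,5),(1,2),(1,3)]), Split 3
     5 (Cite 19 [1,5,4,0,3]) (Split 2 5 (Cite 19 [1,5,4,0,2]) (Split 2 4 (Cite 19 [4,1,5,2,0])
     (Split 3 4 (Cite 19 [4,1,5,3,0]) (Nbr 4 6 (Cite 0 [2,0,1,4,6,3,5])))))),
   (25, ([0], [], []), Nbr 0 1 (Nbr 0 2 (Nbr 0 3 (Split 1 2 (Split 2 3 (Cite 17 [0,1,2,3]) (Split
     1 3 (Cite 17 [1,3,0,2]) (Nbr 1 4 (Cite 19 [0,1,2,3,4])))) (Nbr 1 4 (Split 1 3 (Split 2 3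
     (Cite 17 [3,2,0,1]) (Cite 19 [0,1,3,2,4])) (Nbr 1 5 (Split 0 5 (Split 3 5 (Cite 17 [5,3,0,1])
     (Cite 19 [0,1,5,3,4])) (Split 0 4 (Split 3 4 (Cite 17 [4,3,0,1]) (Cite 19 [0,1,4,3,5]))
     (Split 2 3 (Cite 20 [1,0,4,5,2,3]) (Split 2 5 (Split 3 4 (Split 2 4 (Exit 6 [(0, Cite 0
     [1,0,2,4,3,6,5]), (1, Cite 0 [0,1,4,2,5,6,3]), (2, Cite 0 [0,1,4,2,6,5,3]), (3, Cite 0
     [0,1,4,3,6,5,2]), (4, Cite 0 [1,0,2,4,6,3,5]), (5, Cite 0 [1,0,2,5,6,3,4])]) (Nbr 2 6 (Cite 0
     [4,1,0,2,6,5,3]))) (Nbr 3 6 (Cite 0 [4,1,0,3,6,5,2]))) (Nbr 2 6 (Cite 0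
     [4,1,0,2,6,5,3])))))))))))))]"

lemma check_degree_cert_C:
  "check_all 3 6 [(0, tree_pattern edges_C)] ([0], [], []) degree_cert_C"
  by code_simp

section \<open>Case distinctions for the tree D\<close>

definition edges_D :: edges where
  "edges_D = [(1,2), (2,3), (3,4), (4,5), (3,6), (6,7)]"

text \<open>The first milestone, number 8, is a red copy of the tree B. Number 17 consists of two
  disjoint paths on three vertices, and number 24 is a single red edge.\<close>

definition ramsey_cert_D :: "(nat \<times> pattern \<times> cert) list" where
  "ramsey_cert_D =
   [(2, ([0,1,2,3,4,5,6,7,8,9], [(1,9),(2,3),(2,5),(3,4),(3,9),(6,7),(6,9)],
     [(1,4),(2,9),(4,7),(5,9)]), Split 3 7 (Cite 0 [6,7,3,2,5,9,1]) (Split 1 5 (Cite 0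
     [5,1,9,3,2,6,7]) (Split 4 6 (Cite 0 [6,4,3,2,5,9,1]) (Split 1 2 (Cite 0 [2,1,9,3,4,6,7])
     (Split 3 6 (Cite 0 [7,6,3,2,5,9,1]) (Split 2 6 (Split 5 7 (Cite 0 [5,7,6,2,3,9,1]) (Cite 1
     [5,7,3,6,4,1,2,9])) (Cite 1 [2,6,3,7,4,1,5,9]))))))),
   (3, ([0,1,2,3,4,5,6,7,8,9], [(2,3),(2,5),(2,6),(3,4),(3,9),(6,7),(6,9)],
     [(0,4),(0,9),(1,4),(1,9),(2,9),(4,7),(5,9),(8,9)]), Split 5 7 (Cite 0 [7,5,2,3,4,6,9]) (Split
     7 8 (Cite 0 [8,7,6,2,5,9,3]) (Split 5 8 (Cite 0 [8,5,2,3,4,6,7]) (Split 1 5 (Cite 0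
     [1,5,2,3,4,6,7]) (Split 0 7 (Cite 0 [0,7,6,2,5,9,3]) (Split 1 2 (Split 2 4 (Split 4 5 (Cite 0
     [4,5,2,3,9,6,7]) (Split 1 7 (Cite 0 [1,7,6,2,4,9,3]) (Split 4 6 (Cite 0 [7,6,4,2,1,3,9])
     (Split 1 6 (Split 1 8 (Cite 0 [8,1,2,3,4,6,7]) (Split 5 6 (Split 0 2 (Split 0 6 (Split 1 3
     (Cite 0 [4,3,1,2,0,6,5]) (Split 0 3 (Cite 0 [4,3,0,2,1,6,5]) (Cite 1 [0,3,1,4,5,7,8,9])))
     (Cite 1 [0,6,4,1,5,7,8,9])) (Cite 1 [0,2,9,1,4,5,8,7])) (Cite 1 [5,6,4,0,7,1,8,9]))) (Cite 1
     [1,6,4,0,7,5,8,9]))))) (Cite 1 [2,4,0,7,8,5,1,9])) (Cite 1 [1,2,9,0,4,7,8,5]))))))),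
   (4, ([0,1,2,3,4,5,6,7,8,9], [(2,3),(2,5),(2,7),(3,4),(6,7),(6,9)],
     [(0,9),(1,4),(2,6),(2,9),(4,7),(4,8),(5,9),(8,9)]), Split 3 7 (Cite 0 [4,3,7,2,5,6,9]) (Split
     1 5 (Cite 0 [1,5,2,3,4,7,6]) (Split 0 5 (Cite 0 [0,5,2,3,4,7,6]) (Split 0 7 (Cite 2
     [1,0,3,2,5,4,6,9,8,7]) (Split 5 6 (Split 3 5 (Cite 0 [4,3,5,2,7,6,9]) (Cite 1
     [3,5,1,4,8,9,0,7])) (Cite 1 [5,6,2,9,0,7,4,1])))))),
   (6, ([0,1,2,3,4,5,6,7,8,9], [(2,3),(2,5)],
     [(0,4),(0,9),(1,4),(1,9),(2,6),(2,7),(4,7),(4,8),(5,6),(5,9)]), Split 1 5 (Split 1 8 (Split 0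
     5 (Split 0 7 (Cite 0 [7,0,5,1,8,2,3]) (Cite 1 [0,7,2,6,5,9,1,4])) (Cite 1 [0,5,6,2,7,4,1,9]))
     (Cite 1 [1,8,4,7,2,6,5,9])) (Cite 1 [1,5,6,2,7,4,0,9])),
   (8, ([0,1,2,3,4,5,6,7,8,9], [(2,3),(2,5),(3,4),(3,9),(6,7),(6,9)], []), Split 4 8 (Cite 0
     [8,4,3,2,5,9,6]) (Split 4 7 (Cite 0 [7,4,3,2,5,9,6]) (Split 2 9 (Cite 0 [5,2,9,3,4,6,7])
     (Split 5 9 (Cite 0 [2,5,9,3,4,6,7]) (Split 0 4 (Cite 0 [0,4,3,2,5,9,6]) (Split 1 4 (Cite 0
     [1,4,3,2,5,9,6]) (Split 1 9 (Cite 2 [0,1,2,3,4,5,6,7,8,9]) (Split 8 9 (Cite 2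
     [0,8,2,3,4,5,6,7,1,9]) (Split 0 9 (Cite 2 [1,0,2,3,4,5,6,7,8,9]) (Split 2 6 (Cite 3
     [0,1,2,3,4,5,6,7,8,9]) (Split 2 7 (Cite 4 [0,1,2,3,4,5,6,7,8,9]) (Split 5 6 (Split 3 5 (Cite
     3 [0,1,5,3,4,2,6,7,8,9]) (Split 3 6 (Split 7 8 (Cite 0 [8,7,6,3,4,5,2]) (Split 1 5 (Cite 4
     [0,4,5,6,7,1,3,2,8,9]) (Split 0 5 (Cite 4 [1,4,5,6,7,0,3,2,8,9]) (Cite 1
     [0,5,1,4,8,7,2,9])))) (Cite 1 [3,6,2,7,4,0,9,5]))) (Cite 6
     [0,1,2,3,4,5,6,7,8,9]))))))))))))),
   (9, ([0,1,2,3,4,5,6,7,8,9], [(2,3),(2,5),(3,4),(5,7),(6,7),(6,9)], [(2,7),(3,9)]), Split 4 7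
     (Cite 0 [3,4,7,5,2,6,9]) (Split 3 6 (Cite 8 [0,1,3,6,9,4,5,2,8,7]) (Split 0 5 (Cite 8
     [1,4,2,5,0,3,6,9,8,7]) (Split 5 9 (Cite 8 [0,1,9,5,7,6,3,4,8,2]) (Split 0 2 (Cite 8
     [1,8,3,2,0,4,7,6,9,5]) (Split 4 6 (Cite 8 [0,1,4,6,9,3,5,2,8,7]) (Cite 1
     [4,6,3,9,5,0,2,7]))))))),
   (10, ([0,1,2,3,4,5,6,7,8,9], [(2,3),(2,5),(3,4),(3,6),(6,7),(6,9)], [(2,7),(2,9)]), Split 7 8
     (Cite 8 [0,1,7,6,9,8,2,5,4,3]) (Split 1 9 (Cite 8 [0,4,9,6,7,1,2,5,8,3]) (Split 0 5 (Cite 8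
     [1,8,6,3,4,7,5,0,9,2]) (Split 4 8 (Cite 0 [8,4,3,2,5,6,7]) (Split 0 4 (Cite 0
     [0,4,3,2,5,6,7]) (Split 1 5 (Cite 8 [0,8,6,3,4,7,5,1,9,2]) (Cite 1 [1,5,0,4,8,7,2,9]))))))),
   (11, ([0,1,2,3,4,5,6,7,8,9], [(2,3),(2,5),(3,4),(6,7),(6,9),(7,8)],
     [(2,9),(3,6),(3,7),(3,9),(4,7),(5,7),(5,9)]), Split 4 6 (Cite 8 [0,1,7,6,9,8,3,2,5,4]) (Split
     4 8 (Cite 9 [0,1,4,3,2,8,6,7,5,9]) (Split 2 8 (Cite 8 [0,1,3,2,5,4,7,6,9,8]) (Cite 1
     [2,8,4,6,3,7,5,9])))),
   (14, ([0,1,2,3,4,5,6,7,8,9], [(2,3),(2,5),(3,4),(6,7),(6,9)], [(3,9)]), Split 2 7 (Cite 8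
     [0,1,3,2,5,4,6,9,8,7]) (Split 3 7 (Cite 8 [0,1,2,3,4,5,6,9,8,7]) (Split 2 9 (Cite 8
     [0,1,3,2,5,4,6,7,8,9]) (Split 5 7 (Cite 9 [0,1,2,3,4,5,6,7,8,9]) (Split 4 7 (Cite 9
     [0,1,3,2,5,4,6,7,8,9]) (Split 4 9 (Cite 9 [0,1,3,2,5,4,6,9,8,7]) (Split 5 9 (Cite 9
     [0,1,2,3,4,5,6,9,8,7]) (Split 3 6 (Cite 10 [0,1,2,3,4,5,6,7,8,9]) (Split 2 6 (Cite 10
     [0,1,3,2,5,4,6,7,8,9]) (Split 7 8 (Cite 11 [0,1,2,3,4,5,6,7,8,9]) (Split 1 7 (Cite 11
     [0,8,3,2,5,4,6,7,1,9]) (Split 8 9 (Cite 11 [0,1,3,2,5,4,6,9,8,7]) (Split 1 9 (Cite 11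
     [0,8,3,2,5,4,6,9,1,7]) (Split 0 7 (Cite 11 [1,8,3,2,5,4,6,7,0,9]) (Split 3 5 (Split 0 2
     (Split 2 8 (Split 0 6 (Cite 8 [1,7,0,2,8,6,3,4,9,5]) (Split 0 1 (Cite 8
     [6,7,0,2,8,1,3,4,9,5]) (Split 0 4 (Cite 6 [3,5,0,4,9,2,6,1,8,7]) (Cite 1
     [0,4,7,2,6,3,9,1])))) (Cite 6 [1,4,2,0,7,3,6,8,5,9])) (Cite 6 [1,4,2,5,7,3,6,0,8,9])) (Cite 6
     [1,8,3,4,7,2,6,5,0,9])))))))))))))))),
   (15, ([0,1,2,3,4,5,6,7,8,9], [(2,3),(3,4),(4,9),(6,7),(6,9)], [(2,5)]), Split 8 9 (Cite 8
     [0,1,6,9,8,7,3,2,5,4]) (Split 1 9 (Cite 8 [0,5,6,9,1,7,3,2,8,4]) (Split 1 4 (Cite 8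
     [0,5,3,4,1,2,6,7,8,9]) (Split 2 8 (Cite 14 [0,1,6,9,4,7,2,3,5,8]) (Split 4 5 (Cite 8
     [0,1,3,4,5,2,6,7,8,9]) (Split 0 9 (Cite 8 [1,5,6,9,0,7,3,2,8,4]) (Split 3 8 (Cite 14
     [0,1,6,9,4,7,3,2,5,8]) (Split 0 3 (Cite 14 [1,5,6,9,4,7,3,2,8,0]) (Cite 1
     [0,3,8,2,5,4,1,9]))))))))),
   (17, ([0,1,2,3,4,5,6,7,8,9], [(2,3),(3,4),(6,7),(6,9)], []), Split 2 5 (Split 3 9 (Cite 8
     [0,1,2,3,4,5,6,7,8,9]) (Cite 14 [0,1,2,3,4,5,6,7,8,9])) (Split 4 9 (Cite 15
     [0,1,2,3,4,5,6,7,8,9]) (Split 0 9 (Cite 14 [1,5,6,9,0,7,3,2,8,4]) (Split 2 7 (Cite 15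
     [1,5,9,6,7,0,3,4,8,2]) (Split 8 9 (Cite 14 [0,1,6,9,8,7,3,2,5,4]) (Split 5 7 (Cite 14
     [0,1,6,7,5,9,3,4,8,2]) (Split 1 7 (Cite 14 [0,5,6,7,1,9,3,4,8,2]) (Split 2 8 (Cite 14
     [0,1,3,2,8,4,6,9,5,7]) (Split 1 4 (Cite 14 [0,5,3,4,1,2,6,7,8,9]) (Split 0 4 (Cite 14
     [1,5,3,4,0,2,6,7,8,9]) (Cite 1 [0,4,1,7,5,2,8,9]))))))))))),
   (18, ([0,1,2,3,4,5,6,7,8,9], [(2,9),(3,4),(6,9)], [(1,9),(5,6),(5,9),(6,8)]), Split 0 4 (Cite
     17 [1,5,0,4,3,7,9,2,8,6]) (Split 1 4 (Cite 17 [0,5,1,4,3,7,9,2,8,6]) (Split 0 3 (Cite 17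
     [1,5,0,3,4,7,9,2,8,6]) (Split 3 8 (Cite 17 [0,1,8,3,4,5,9,2,7,6]) (Cite 1
     [3,8,6,5,9,1,4,0]))))),
   (19, ([0,1,2,3,4,5,6,7,8,9], [(0,7),(2,3),(3,4)], [(1,9),(2,6),(2,9),(6,8)]), Split 1 7 (Cite
     17 [5,6,1,7,0,8,3,2,9,4]) (Split 5 7 (Cite 17 [1,6,5,7,0,8,3,2,9,4]) (Split 0 5 (Cite 17
     [1,6,5,0,7,8,3,2,9,4]) (Split 0 8 (Cite 17 [1,5,8,0,7,6,3,2,9,4]) (Cite 1
     [0,8,6,2,9,1,7,5]))))),
   (21, ([0,1,2,3,4,5,6,7,8,9], [(2,3),(3,4),(6,9)], [(6,7)]), Split 8 9 (Cite 17
     [0,1,8,9,6,5,3,2,7,4]) (Split 6 8 (Cite 17 [0,1,8,6,9,5,3,2,7,4]) (Split 1 9 (Cite 17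
     [0,5,1,9,6,7,3,2,8,4]) (Split 5 9 (Cite 17 [0,1,5,9,6,7,3,2,8,4]) (Split 0 6 (Cite 17
     [1,5,0,6,9,7,3,2,8,4]) (Split 0 9 (Cite 17 [1,5,0,9,6,7,3,2,8,4]) (Split 5 6 (Cite 17
     [0,1,5,6,9,7,3,2,8,4]) (Split 1 6 (Cite 17 [0,5,1,6,9,7,3,2,8,4]) (Split 2 9 (Cite 18
     [0,1,2,3,4,5,6,7,8,9]) (Split 2 6 (Cite 18 [7,1,2,3,4,0,9,8,5,6]) (Split 0 7 (Cite 19
     [0,1,2,3,4,5,6,7,8,9]) (Split 0 5 (Cite 19 [0,1,2,3,4,8,6,5,7,9]) (Split 1 8 (Cite 19
     [1,0,2,3,4,7,6,8,5,9]) (Split 1 5 (Cite 19 [1,0,2,3,4,8,6,5,7,9]) (Cite 1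
     [1,5,0,7,6,2,9,8]))))))))))))))),
   (22, ([0,1,2,3,4,5,6,7,8,9], [(2,3),(6,9)], [(3,4)]), Split 1 9 (Cite 21 [0,5,1,9,6,7,3,4,8,2])
     (Split 0 6 (Cite 21 [1,5,0,6,9,7,3,4,8,2]) (Split 0 9 (Cite 21 [1,5,0,9,6,7,3,4,8,2]) (Split
     3 8 (Cite 21 [1,4,8,3,2,5,6,0,7,9]) (Split 2 8 (Cite 21 [1,4,8,2,3,5,6,0,7,9]) (Split 1 2
     (Cite 21 [4,5,1,2,3,7,6,0,8,9]) (Split 4 6 (Cite 21 [0,5,4,6,9,7,2,1,8,3]) (Cite 1
     [4,6,0,9,1,2,8,3])))))))),
   (24, ([0,1,2,3,4,5,6,7,8,9], [(6,9)], []), Split 2 3 (Split 3 4 (Split 6 7 (Cite 17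
     [0,1,2,3,4,5,6,7,8,9]) (Cite 21 [0,1,2,3,4,5,6,7,8,9])) (Cite 22 [0,1,2,3,4,5,6,7,8,9]))
     (Split 2 8 (Cite 22 [0,1,8,2,3,4,6,5,7,9]) (Split 3 5 (Cite 22 [0,1,5,3,2,4,6,7,8,9]) (Split
     7 8 (Cite 22 [0,1,7,8,2,3,6,4,5,9]) (Split 1 3 (Cite 22 [0,4,1,3,2,5,6,7,8,9]) (Split 3 4
     (Cite 22 [0,2,4,3,1,5,6,7,8,9]) (Split 0 1 (Cite 22 [2,4,0,1,3,5,6,7,8,9]) (Split 4 5 (Cite
     22 [0,1,4,5,3,2,6,7,8,9]) (Split 1 5 (Cite 22 [0,2,1,5,3,4,6,7,8,9]) (Split 0 7 (Cite 22
     [1,2,0,7,8,3,6,4,5,9]) (Cite 1 [0,7,8,2,3,4,5,1]))))))))))),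
   (26, ([0,1,2,3,4,5,6,7,8,9], [], []), Split 6 9 (Cite 24 [0,1,2,3,4,5,6,7,8,9]) (Split 3 7
     (Cite 24 [0,1,2,4,5,6,3,8,9,7]) (Split 5 8 (Cite 24 [0,1,2,3,4,6,5,7,9,8]) (Split 2 6 (Cite
     24 [0,1,3,4,5,7,2,8,9,6]) (Split 3 8 (Cite 24 [0,1,2,4,5,6,3,7,9,8]) (Split 2 4 (Cite 24
     [0,1,3,5,6,7,2,8,9,4]) (Split 5 9 (Cite 24 [0,1,2,3,4,6,5,7,8,9]) (Split 4 7 (Cite 24
     [0,1,2,3,5,6,4,8,9,7]) (Cite 1 [4,7,3,8,5,9,6,2])))))))))]"

lemma check_ramsey_cert_D:
  "check_all 0 0 [(0, tree_pattern edges_D), (1, cycle_pattern)] ([0,1,2,3,4,5,6,7,8,9], [], [])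
     ramsey_cert_D"
  by code_simp

text \<open>Now K_5 satisfies the degree condition, and \<open>Exit\<close> leaves it inside number
  5, which excludes \<open>W_4\<close>. Number 6 is K_4 minus an edge with a pendant edge at a
  vertex of degree 3, and number 7 is a triangle with pendant edges at two of its vertices.\<close>

definition degree_cert_D :: "(nat \<times> pattern \<times> cert) list" where
  "degree_cert_D =
   [(2, ([0,1,2,3,4,5], [(0,1),(0,2),(0,3),(1,2),(1,3),(1,4),(2,3),(2,4),(3,4),(4,5)], []), Split
     2 5 (Exit 6 [(0, Cite 0 [1,2,3,0,6,4,5]), (1, Cite 0 [0,2,3,1,6,4,5]), (2, Cite 0
     [0,1,3,2,6,4,5]), (3, Cite 0 [0,1,2,3,6,4,5]), (4, Cite 0 [0,1,3,2,5,4,6]), (5, Cite 0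
     [0,1,2,3,4,5,6])]) (Split 3 5 (Exit 6 [(0, Cite 0 [1,2,3,0,6,4,5]), (1, Cite 0
     [0,2,3,1,6,4,5]), (2, Cite 0 [0,1,3,2,6,4,5]), (3, Cite 0 [0,1,2,3,6,4,5]), (4, Cite 0
     [0,1,2,3,5,4,6]), (5, Cite 0 [0,1,3,2,4,5,6])]) (Nbr 5 6 (Cite 0 [0,1,4,2,3,5,6])))),
   (3, ([0,1,2,3,4,5], [(0,1),(0,2),(0,4),(1,2),(2,4),(2,5),(3,4),(3,5)], [(0,5)]), Split 1 5
     (Exit 6 [(0, Cite 0 [1,2,4,0,6,3,5]), (1, Cite 0 [0,2,5,1,6,3,4]), (2, Cite 0
     [0,1,5,2,6,3,4]), (3, Cite 0 [0,1,5,2,4,3,6]), (4, Cite 0 [0,1,2,4,6,5,3]), (5, Cite 0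
     [0,1,2,4,3,5,6])]) (Nbr 5 6 (Cite 0 [0,1,2,4,3,5,6]))),
   (5, ([0,1,2,3,4], [(0,1),(0,2),(0,3),(0,4),(1,2),(1,3),(2,4),(3,4)], []), Split 2 3 (Split 1 4
     (Exit 5 [(0, Cite 2 [1,2,3,4,0,5]), (1, Cite 2 [0,2,3,4,1,5]), (2, Cite 2 [0,1,3,4,2,5]), (3,
     Cite 2 [0,1,2,4,3,5]), (4, Cite 2 [0,1,2,3,4,5])]) (Nbr 1 5 (Cite 2 [4,0,2,3,1,5]))) (Nbr 3 5
     (Split 1 4 (Cite 2 [2,1,4,0,3,5]) (Split 2 5 (Split 0 5 (Split 1 5 (Cite 2 [3,1,5,0,2,4])
     (Nbr 1 6 (Cite 0 [0,4,2,1,6,5,3]))) (Cite 3 [0,1,2,3,4,5])) (Split 0 5 (Cite 3 [2,4,0,3,1,5])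
     (Split 4 5 (Cite 3 [4,5,3,2,0,1]) (Split 1 5 (Cite 3 [1,5,3,2,0,4]) (Nbr 5 6 (Cite 0
     [0,1,3,4,2,5,6]))))))))),
   (6, ([0,1,2,3,4], [(0,1),(0,2),(0,3),(0,4),(1,2),(1,3)], []), Split 3 4 (Split 2 4 (Cite 5
     [0,1,2,3,4]) (Nbr 4 5 (Split 0 5 (Cite 3 [4,5,0,1,3,2]) (Split 1 5 (Cite 3 [0,2,1,4,3,5])
     (Nbr 5 6 (Cite 0 [1,3,4,0,2,5,6])))))) (Nbr 3 5 (Split 4 5 (Split 1 4 (Split 1 5 (Cite 5
     [1,5,3,4,0]) (Split 0 5 (Cite 5 [0,5,3,4,1]) (Nbr 5 6 (Cite 0 [2,0,3,1,4,5,6])))) (Cite 3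
     [1,2,0,5,3,4])) (Nbr 4 6 (Cite 0 [1,2,0,3,5,4,6]))))),
   (7, ([0,1,2,3,4], [(0,1),(0,3),(0,4),(1,2),(1,3)], []), Split 0 2 (Cite 6 [0,1,2,3,4]) (Split 1
     4 (Cite 6 [1,0,4,3,2]) (Nbr 1 5 (Split 0 5 (Cite 6 [0,1,5,3,4]) (Split 2 3 (Cite 6
     [1,3,2,0,5]) (Split 3 5 (Cite 6 [1,3,5,0,2]) (Nbr 2 6 (Split 4 5 (Cite 0 [4,5,1,0,3,2,6])
     (Nbr 5 7 (Cite 0 [0,3,1,2,6,5,7])))))))))),
   (8, ([0], [], []), Nbr 0 1 (Nbr 1 2 (Nbr 0 3 (Nbr 0 4 (Split 1 3 (Cite 7 [0,1,2,3,4]) (Split 1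
     4 (Cite 7 [1,0,3,4,2]) (Nbr 4 5 (Split 3 4 (Cite 7 [4,0,1,3,5]) (Nbr 4 6 (Split 3 6 (Cite 0
     [6,3,0,1,2,4,5]) (Split 3 5 (Cite 0 [5,3,0,1,2,4,6]) (Nbr 3 7 (Cite 0
     [2,1,0,3,7,4,5])))))))))))))]"

lemma check_degree_cert_D:
  "check_all 4 6 [(0, tree_pattern edges_D)] ([0], [], []) degree_cert_D"
  by code_simp

section \<open>Case distinctions for the tree E\<close>

definition edges_E :: edges where
  "edges_E = [(1,2), (2,3), (3,4), (4,5), (2,6), (4,7)]"

text \<open>The first milestone, number 7, is a red copy of the tree A. Number 16 is a path on four
  vertices with a disjoint edge.\<close>

definition ramsey_cert_E :: "(nat \<times> pattern \<times> cert) list" where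
  "ramsey_cert_E =
   [(2, ([0,1,2,3,4,5,6,7,8,9], [(1,8),(2,8),(3,4),(3,6),(3,7),(5,7),(5,8)],
     [(0,5),(1,5),(4,8),(5,9),(6,8),(7,8)]), Split 2 3 (Cite 0 [4,3,2,8,1,6,5]) (Split 0 7 (Cite 0
     [0,7,5,8,1,3,2]) (Split 3 5 (Cite 0 [4,3,5,8,1,6,2]) (Split 6 7 (Cite 0 [6,7,5,8,1,3,2])
     (Split 2 4 (Split 1 2 (Cite 0 [1,2,4,3,6,8,7]) (Split 0 2 (Cite 0 [0,2,4,3,6,8,7]) (Split 4 9
     (Cite 0 [9,4,2,8,1,3,5]) (Cite 1 [4,9,5,1,2,0,7,8])))) (Cite 1 [2,4,8,6,7,0,5,3])))))),
   (3, ([0,1,2,3,4,5,6,7,8,9], [(1,8),(3,4),(3,6),(3,7),(5,6),(5,7),(5,8)],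
     [(0,5),(0,8),(1,5),(2,5),(2,8),(4,8),(5,9),(6,8),(7,8)]), Split 0 3 (Cite 0 [0,3,6,5,7,4,8])
     (Split 3 9 (Cite 0 [9,3,6,5,7,4,8]) (Split 1 3 (Cite 0 [1,3,6,5,7,4,8]) (Split 1 2 (Split 1 7
     (Cite 0 [2,1,7,3,4,8,6]) (Split 1 9 (Cite 0 [9,1,8,5,6,2,7]) (Cite 1 [1,9,3,0,5,2,8,7])))
     (Split 6 9 (Split 2 4 (Split 0 4 (Cite 0 [0,4,3,6,5,2,9]) (Cite 1 [0,4,8,2,1,3,9,5])) (Cite 1
     [2,4,8,0,3,9,5,1])) (Cite 1 [6,9,3,0,5,1,2,8])))))),
   (4, ([0,1,2,3,4,5,6,7,8,9], [(1,8),(1,9),(3,4),(3,6),(3,7)],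
     [(0,5),(0,8),(2,5),(2,8),(4,5),(6,8),(7,8),(8,9)]), Split 1 6 (Cite 0 [8,1,6,3,4,9,7]) (Split
     1 4 (Cite 0 [8,1,4,3,6,9,7]) (Split 0 9 (Split 6 9 (Cite 0 [0,9,6,3,4,1,7]) (Split 7 9 (Cite
     0 [0,9,7,3,4,1,6]) (Cite 1 [7,9,6,1,4,5,0,8]))) (Split 0 2 (Split 2 6 (Split 2 9 (Cite 0
     [9,2,6,3,4,0,7]) (Cite 1 [2,9,0,5,4,1,6,8])) (Cite 1 [2,6,1,4,5,0,9,8])) (Cite 1
     [0,2,5,4,1,6,8,9]))))),
   (7, ([0,1,2,3,4,5,6,7,8,9], [(1,8),(3,4),(3,6),(3,7),(5,7),(5,8)], []), Split 5 9 (Cite 0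
     [9,5,7,3,4,8,6]) (Split 6 8 (Cite 0 [1,8,6,3,4,5,7]) (Split 2 5 (Cite 0 [2,5,7,3,4,8,6])
     (Split 4 8 (Cite 0 [1,8,4,3,6,5,7]) (Split 0 5 (Cite 0 [0,5,7,3,4,8,6]) (Split 1 5 (Cite 0
     [1,5,7,3,4,8,6]) (Split 7 8 (Cite 0 [1,8,7,3,4,5,6]) (Split 2 8 (Cite 2
     [0,1,2,3,4,5,6,7,8,9]) (Split 8 9 (Cite 2 [0,9,1,3,4,5,6,7,8,2]) (Split 0 8 (Cite 2
     [2,0,1,3,4,5,6,7,8,9]) (Split 4 5 (Cite 3 [0,1,2,3,6,5,4,7,8,9]) (Split 1 9 (Cite 4
     [0,1,2,3,4,5,6,7,8,9]) (Split 0 1 (Cite 4 [2,1,9,3,4,5,6,7,8,0]) (Split 1 2 (Cite 4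
     [0,1,9,3,4,5,6,7,8,2]) (Split 3 9 (Cite 4 [0,5,2,3,9,1,4,6,8,7]) (Split 0 3 (Cite 4
     [2,5,9,3,0,1,4,6,8,7]) (Cite 1 [0,3,9,1,2,5,4,8]))))))))))))))))),
   (8, ([0,1,2,3,4,5,6,7,8,9], [(1,8),(3,4),(3,6),(3,7),(4,8),(5,7)], [(5,8)]), Split 2 8 (Cite 0
     [2,8,4,3,6,1,7]) (Split 6 7 (Cite 7 [0,1,2,7,6,4,5,3,8,9]) (Split 0 1 (Cite 7
     [2,0,5,3,6,8,7,4,1,9]) (Split 0 7 (Cite 7 [2,1,6,7,0,4,5,3,8,9]) (Split 2 7 (Cite 7
     [0,1,6,7,2,4,5,3,8,9]) (Split 0 8 (Cite 0 [0,8,4,3,6,1,7]) (Split 1 2 (Cite 7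
     [0,2,5,3,6,8,7,4,1,9]) (Split 6 8 (Cite 7 [0,5,2,8,6,3,1,4,7,9]) (Split 1 9 (Cite 7
     [0,9,2,3,6,8,7,4,1,5]) (Split 0 5 (Split 5 9 (Cite 0 [9,5,7,3,4,0,6]) (Split 2 5 (Cite 0
     [2,5,7,3,4,0,6]) (Cite 1 [2,5,9,1,0,7,6,8]))) (Split 0 9 (Split 5 9 (Cite 7
     [1,0,2,3,4,5,6,7,9,8]) (Cite 1 [5,9,1,2,7,6,8,0])) (Cite 1 [0,9,1,2,7,6,8,5])))))))))))),
   (9, ([0,1,2,3,4,5,6,7,8,9], [(0,5),(3,4),(3,6),(3,7),(5,7)], [(1,5),(6,8)]), Split 0 8 (Cite 7
     [1,8,2,3,4,5,6,7,0,9]) (Split 2 5 (Cite 0 [2,5,7,3,4,0,6]) (Split 2 6 (Cite 8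
     [1,0,8,3,7,2,4,6,5,9]) (Split 0 1 (Cite 7 [2,1,8,3,4,5,6,7,0,9]) (Split 2 4 (Cite 8
     [1,0,8,3,7,2,6,4,5,9]) (Split 5 9 (Cite 0 [9,5,7,3,4,0,6]) (Split 4 9 (Cite 8
     [1,0,2,3,7,9,6,4,5,8]) (Cite 1 [4,9,5,1,0,8,6,2])))))))),
   (12, ([0,1,2,3,4,5,6,7,8,9], [(1,8),(3,4),(3,6),(3,7),(5,7)], [(1,5),(4,8),(5,8)]), Split 1 4
     (Cite 8 [0,8,2,3,4,5,6,7,1,9]) (Split 1 6 (Cite 8 [0,8,2,3,6,5,4,7,1,9]) (Split 6 8 (Cite 8
     [0,1,2,3,6,5,4,7,8,9]) (Split 0 5 (Cite 9 [0,1,2,3,4,5,6,7,8,9]) (Split 5 9 (Cite 9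
     [9,0,2,3,6,5,4,7,1,8]) (Split 2 5 (Cite 9 [2,0,8,3,6,5,4,7,1,9]) (Split 4 9 (Split 0 9 (Cite
     8 [1,0,2,3,4,5,6,7,9,8]) (Split 0 7 (Cite 9 [9,1,6,7,0,4,5,3,2,8]) (Split 6 7 (Cite 9
     [9,1,2,7,6,4,5,3,0,8]) (Cite 1 [6,7,0,9,5,1,4,8])))) (Split 1 7 (Cite 9
     [8,5,0,3,6,1,4,7,9,2]) (Split 7 8 (Cite 9 [1,5,0,3,6,8,4,7,9,2]) (Split 2 6 (Split 0 7 (Cite
     9 [2,1,4,7,0,6,5,3,8,9]) (Cite 1 [0,7,1,6,8,4,9,5])) (Cite 1 [2,6,1,7,8,4,9,5]))))))))))),
   (13, ([0,1,2,3,4,5,6,7,8,9], [(1,8),(3,4),(3,7),(4,8),(5,7)], [(3,6)]), Split 6 7 (Cite 7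
     [0,1,2,7,6,4,5,3,8,9]) (Split 2 7 (Cite 7 [0,1,6,7,2,4,5,3,8,9]) (Split 0 8 (Cite 7
     [2,5,6,8,0,3,1,4,7,9]) (Split 2 4 (Cite 9 [5,6,1,4,2,7,8,3,0,9]) (Split 7 9 (Cite 7
     [0,1,2,7,9,4,5,3,8,6]) (Split 5 8 (Cite 9 [3,6,0,8,1,7,4,5,2,9]) (Split 3 5 (Cite 9
     [1,0,6,3,5,8,7,4,2,9]) (Split 2 8 (Cite 7 [0,5,6,8,2,3,1,4,7,9]) (Split 4 9 (Cite 9
     [5,2,1,4,9,7,8,3,0,6]) (Cite 1 [4,9,7,6,3,5,8,2])))))))))),
   (16, ([0,1,2,3,4,5,6,7,8,9], [(1,8),(3,4),(3,7),(5,7)], []), Split 3 6 (Split 5 8 (Cite 7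
     [0,1,2,3,4,5,6,7,8,9]) (Split 1 5 (Cite 7 [0,8,2,3,4,5,6,7,1,9]) (Split 4 8 (Cite 8
     [0,1,2,3,4,5,6,7,8,9]) (Cite 12 [0,1,2,3,4,5,6,7,8,9])))) (Split 4 8 (Cite 13
     [0,1,2,3,4,5,6,7,8,9]) (Split 1 4 (Cite 13 [0,8,2,3,4,5,6,7,1,9]) (Split 5 8 (Split 0 7 (Cite
     8 [2,1,6,7,5,4,0,3,8,9]) (Cite 13 [2,1,6,7,5,4,0,3,8,9])) (Split 6 7 (Cite 12
     [0,1,2,7,5,4,6,3,8,9]) (Split 0 7 (Cite 12 [2,1,6,7,5,4,0,3,8,9]) (Split 2 7 (Cite 12
     [0,1,6,7,5,4,2,3,8,9]) (Split 1 5 (Cite 13 [2,8,6,7,5,4,0,3,1,9]) (Split 3 9 (Cite 12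
     [0,8,2,3,4,5,9,7,1,6]) (Split 2 3 (Cite 12 [0,8,6,3,4,5,2,7,1,9]) (Split 0 3 (Cite 12
     [2,8,6,3,4,5,0,7,1,9]) (Split 2 4 (Split 2 9 (Cite 13 [1,9,6,3,4,5,0,7,2,8]) (Split 2 8 (Cite
     13 [1,8,6,3,4,5,0,7,2,9]) (Split 1 7 (Cite 13 [5,2,6,7,3,8,0,1,4,9]) (Cite 1
     [1,7,0,3,9,2,8,4])))) (Split 3 8 (Split 0 5 (Cite 13 [4,0,6,3,7,1,2,8,5,9]) (Cite 1
     [0,5,1,4,2,3,6,7])) (Cite 1 [3,8,5,1,4,2,7,0])))))))))))))),
   (17, ([0,1,2,3,4,5,6,7,8,9], [(1,8),(3,7),(5,7),(6,9)], [(0,3),(0,5),(3,9)]), Split 7 9 (Cite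
     16 [0,1,2,7,3,6,4,9,8,5]) (Split 1 6 (Cite 16 [0,3,2,1,8,9,4,6,7,5]) (Split 6 8 (Cite 16
     [0,3,2,6,9,1,4,8,7,5]) (Split 5 8 (Cite 16 [0,6,1,5,8,3,2,7,9,4]) (Split 1 7 (Cite 16
     [0,6,2,1,8,3,4,7,9,5]) (Cite 1 [1,7,9,3,0,5,8,6])))))),
   (19, ([0,1,2,3,4,5,6,7,8,9], [(1,8),(3,7),(5,7)], [(3,4)]), Split 5 9 (Cite 16
     [0,1,2,5,9,3,4,7,8,6]) (Split 5 6 (Cite 16 [0,1,2,5,6,3,4,7,8,9]) (Split 4 5 (Cite 16
     [0,1,2,5,4,3,6,7,8,9]) (Split 2 5 (Cite 16 [0,1,4,5,2,3,6,7,8,9]) (Split 3 6 (Cite 16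
     [0,1,2,3,6,5,4,7,8,9]) (Split 0 5 (Cite 16 [2,1,4,5,0,3,6,7,8,9]) (Split 3 9 (Cite 16
     [0,1,2,3,9,5,4,7,8,6]) (Split 0 3 (Cite 16 [2,1,4,3,0,5,6,7,8,9]) (Split 2 3 (Cite 16
     [0,1,4,3,2,5,6,7,8,9]) (Split 6 9 (Cite 17 [0,1,2,3,4,5,6,7,8,9]) (Split 2 6 (Cite 17
     [0,1,4,3,9,5,2,7,8,6]) (Split 0 2 (Cite 17 [4,1,6,3,9,5,0,7,8,2]) (Split 0 9 (Cite 17
     [2,1,4,3,6,5,0,7,8,9]) (Split 0 6 (Cite 17 [2,1,4,3,9,5,0,7,8,6]) (Split 2 4 (Cite 17
     [0,1,6,3,9,5,2,7,8,4]) (Split 0 1 (Split 6 8 (Cite 16 [2,3,4,8,6,0,5,1,7,9]) (Split 4 8 (Cite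
     16 [2,3,5,8,4,0,6,1,7,9]) (Cite 1 [4,8,6,0,2,3,9,5]))) (Split 1 6 (Split 1 3 (Split 2 7 (Cite
     0 [2,7,3,1,6,5,8]) (Cite 9 [5,2,4,1,8,7,6,3,0,9])) (Cite 1 [1,3,2,4,5,6,9,0])) (Cite 1
     [1,6,2,3,4,5,9,0])))))))))))))))))),
   (20, ([0,1,2,3,4,5,6,7,8,9], [(1,8),(3,7)], [(5,7)]), Split 3 6 (Cite 19 [0,1,2,7,5,6,4,3,8,9])
     (Split 2 7 (Cite 19 [0,1,4,3,6,2,5,7,8,9]) (Split 7 9 (Cite 19 [0,1,2,3,6,9,4,7,8,5]) (Split
     0 3 (Cite 19 [4,1,5,7,2,0,6,3,8,9]) (Split 0 7 (Cite 19 [2,1,4,3,6,0,5,7,8,9]) (Split 3 4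
     (Cite 19 [2,1,5,7,0,4,6,3,8,9]) (Split 1 9 (Split 6 8 (Cite 16 [0,3,2,8,6,9,4,1,7,5]) (Cite
     19 [0,3,2,8,6,9,4,1,7,5])) (Split 0 8 (Cite 19 [2,3,4,1,9,0,5,8,7,6]) (Split 2 8 (Cite 19
     [0,3,4,1,9,2,5,8,7,6]) (Split 1 4 (Cite 19 [2,3,5,8,0,4,6,1,7,9]) (Cite 1
     [1,4,3,0,8,2,7,9]))))))))))),
   (21, ([0,1,2,3,4,5,6,7,8,9], [(1,8)], [(3,7)]), Split 0 3 (Cite 20 [2,1,4,0,5,7,6,3,8,9])
     (Split 3 4 (Cite 20 [2,1,5,4,6,0,7,3,8,9]) (Split 4 7 (Cite 20 [0,1,2,4,5,3,6,7,8,9]) (Split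
     6 7 (Cite 20 [0,1,2,6,4,3,5,7,8,9]) (Split 5 6 (Cite 20 [0,1,2,5,3,7,4,6,8,9]) (Split 0 9
     (Cite 20 [2,1,4,9,5,3,6,0,8,7]) (Split 2 5 (Cite 20 [0,1,3,2,4,6,7,5,8,9]) (Split 2 9 (Cite
     20 [3,1,4,2,5,0,6,9,8,7]) (Cite 1 [2,9,0,3,4,7,6,5]))))))))),
   (24, ([0,1,2,3,4,5,6,7,8,9], [], []), Split 1 8 (Split 3 7 (Split 5 7 (Split 3 4 (Cite 16
     [0,1,2,3,4,5,6,7,8,9]) (Cite 19 [0,1,2,3,4,5,6,7,8,9])) (Cite 20 [0,1,2,3,4,5,6,7,8,9]))
     (Cite 21 [0,1,2,3,4,5,6,7,8,9])) (Split 2 7 (Cite 21 [0,2,3,1,4,5,6,8,7,9]) (Split 6 7 (Cite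
     21 [0,6,2,1,3,4,5,8,7,9]) (Split 2 4 (Cite 21 [0,2,3,1,5,6,7,8,4,9]) (Split 6 9 (Cite 21
     [0,6,2,1,3,4,5,8,9,7]) (Split 8 9 (Cite 21 [0,8,1,2,3,5,6,4,9,7]) (Split 0 4 (Cite 21
     [2,0,3,1,5,6,7,8,4,9]) (Split 0 1 (Cite 21 [3,0,5,2,6,7,8,4,1,9]) (Cite 1
     [0,1,8,9,6,7,2,4])))))))))]"

lemma check_ramsey_cert_E:
  "check_all 0 0 [(0, tree_pattern edges_E), (1, cycle_pattern)] ([0,1,2,3,4,5,6,7,8,9], [], [])
     ramsey_cert_E"
  by code_simp

text \<open>The search starts from an edge \<open>0\<close>-\<open>1\<close> with two more
  neighbours at each end. If a leaf at \<open>0\<close> has two suitable further neighbours, that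
  leaf and \<open>1\<close> become the branch vertices of E, with \<open>0\<close> between them.
  Number 1 is needed because K_6 meets the degree condition and can only be left by
  \<open>Exit\<close>.\<close>

definition degree_cert_E :: "(nat \<times> pattern \<times> cert) list" where
  "degree_cert_E =
   [(1, ([0,1,2,3,4,5], [(0,1),(0,2),(1,2),(1,3),(1,4),(1,5),(2,3),(2,4),(2,5),(3,4),(3,5)], []),
     Exit 6 [(0, Cite 0 [1,0,2,3,4,6,5]), (1, Cite 0 [0,1,2,3,4,6,5]), (2, Cite 0
     [0,1,3,2,4,5,6]), (3, Cite 0 [0,1,2,3,4,5,6]), (4, Cite 0 [0,1,2,4,3,5,6]), (5, Cite 0
     [0,1,2,5,3,4,6])]),
   (3, ([0], [], []), Nbr 0 1 (Nbr 0 2 (Nbr 1 3 (Nbr 0 4 (Nbr 1 5 (Split 2 5 (Split 4 5 (Split 1 4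
     (Split 2 4 (Split 1 2 (Split 3 4 (Cite 1 [3,4,1,2,0,5]) (Nbr 4 6 (Cite 0 [0,1,2,4,5,3,6])))
     (Nbr 2 6 (Cite 0 [0,1,4,2,5,3,6]))) (Nbr 2 6 (Cite 0 [0,2,5,1,3,6,4]))) (Nbr 4 6 (Split 2 4
     (Cite 0 [2,4,0,1,3,6,5]) (Nbr 4 7 (Cite 0 [0,1,5,4,6,3,7]))))) (Nbr 5 6 (Split 3 5 (Cite 0
     [3,5,1,0,2,6,4]) (Nbr 5 7 (Cite 0 [1,0,2,5,6,4,7]))))) (Nbr 2 6 (Split 2 4 (Cite 0
     [4,2,0,1,3,6,5]) (Nbr 2 7 (Cite 0 [3,1,0,2,6,5,7]))))))))))]"

lemma check_degree_cert_E:
  "check_all 5 6 [(0, tree_pattern edges_E)] ([0], [], []) degree_cert_E"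
  by code_simp

section \<open>The five Ramsey numbers\<close>

text \<open>The two checks give the upper bound through \<open>no_counterexample\<close>. The graph
  on \<open>9 + d\<close> vertices, of order 12, 13 or 14 in the applications, makes it
  sharp.\<close>

lemma ramsey_number_tree_wheel8:
  assumes checks: "check_all 0 0 [(0, tree_pattern es), (1, cycle_pattern)] ([0,1,2,3,4,5,6,7,8,9], [], []) cs"
      "check_all d 6 [(0, tree_pattern es)] ([0], [], []) cs'"
    and es: "set es \<subseteq> {1..7} \<times> {1..7}" and d: "d \<ge> 3" and r: "symp r"
    and no_tree: "\<not> contains_subgraph (graph_on (9 + d) r) (graph_of {1..7} (set es))"
    and no_wheel: "\<not> contains_subgraph (complement (graph_on (9 + d) r)) (wheel 8)"
  shows "ramsey_number (graph_of {1..7} (set es)) (wheel 8) = 10 + d"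
proof -
  have upper: "contains_subgraph F (graph_of {1..7} (set es)) \<or> contains_subgraph (complement F) (wheel 8)"
    if F: "pair_graph F" "card (pverts F) = Suc (9 + d)" for F :: "nat pair_pre_digraph"
  proof (rule ccontr)
    assume "\<not> ?thesis"
    then have "counterexample F es d"
      using F es by (intro counterexample.intro) simp_all
    then show False
      using counterexample.no_counterexample checks(2,1) d by blast
  qed
  have "ramsey_number (graph_of {1..7} (set es)) (wheel 8) = Suc (9 + d)"
    using upper no_tree no_wheel unfolding wheel_def
    by (intro ramsey_number_eqI[OF es wheel_subset _ pair_graph_on[OF r] card_graph_on])
  then show ?thesis by simp
qed

lemma ramsey_number_A: "ramsey_number tree_A (wheel 8) = 13"
proof -
  have sub: "set edges_A \<subseteq> {1..7} \<times> {1..7}"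
    by (simp add: edges_A_def)
  have set: "{1..7} = {1,2,3,4,5,6,7::nat}"
    by auto
  \<comment> \<open>This is the connectedness of A in the form that \<open>two_K6_no_tree\<close>
    expects.\<close>
  have "\<forall>i\<in>{1..7}. P i = P 1" if "\<forall>(u, v) \<in> set edges_A. P u = P v" for P :: "nat \<Rightarrow> bool"
    using that unfolding set edges_A_def by auto
  then have no_tree: "\<not> contains_subgraph (graph_on 12 two_K6) (graph_of {1..7} (set edges_A))"
    using two_K6_no_tree[OF sub] by blast
  show ?thesis
    using ramsey_number_tree_wheel8[OF check_ramsey_cert_A check_degree_cert_A sub _ symp_two_K6]
      no_tree two_K6_no_wheel
    by (simp add: tree_A_def edges_A_def)
qed

lemma ramsey_number_B: "ramsey_number tree_B (wheel 8) = 13"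
proof -
  have sub: "set edges_B \<subseteq> {1..7} \<times> {1..7}"
    by (simp add: edges_B_def)
  have set: "{1..7} = {1,2,3,4,5,6,7::nat}"
    by auto
  have "\<forall>i\<in>{1..7}. P i = P 1" if "\<forall>(u, v) \<in> set edges_B. P u = P v" for P :: "nat \<Rightarrow> bool"
    using that unfolding set edges_B_def by auto
  then have no_tree: "\<not> contains_subgraph (graph_on 12 two_K6) (graph_of {1..7} (set edges_B))"
    using two_K6_no_tree[OF sub] by blast
  show ?thesis
    using ramsey_number_tree_wheel8[OF check_ramsey_cert_B check_degree_cert_B sub _ symp_two_K6]
      no_tree two_K6_no_wheel
    by (simp add: tree_B_def edges_B_def)
qed

lemma ramsey_number_C: "ramsey_number tree_C (wheel 8) = 13"
proof -
  have sub: "set edges_C \<subseteq> {1..7} \<times> {1..7}"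
    by (simp add: edges_C_def)
  have set: "{1..7} = {1,2,3,4,5,6,7::nat}"
    by auto
  have "\<forall>i\<in>{1..7}. P i = P 1" if "\<forall>(u, v) \<in> set edges_C. P u = P v" for P :: "nat \<Rightarrow> bool"
    using that unfolding set edges_C_def by auto
  then have no_tree: "\<not> contains_subgraph (graph_on 12 two_K6) (graph_of {1..7} (set edges_C))"
    using two_K6_no_tree[OF sub] by blast
  show ?thesis
    using ramsey_number_tree_wheel8[OF check_ramsey_cert_C check_degree_cert_C sub _ symp_two_K6]
      no_tree two_K6_no_wheel
    by (simp add: tree_C_def edges_C_def)
qed

lemma ramsey_number_D: "ramsey_number tree_D (wheel 8) = 14"
proof -
  have sub: "set edges_D \<subseteq> {1..7} \<times> {1..7}"
    by (simp add: edges_D_def)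
  have no_tree: "\<not> contains_subgraph (graph_on 13 K6_bowtie) (graph_of {1..7} (set edges_D))"
    using K6_bowtie_no_tree_D by (simp add: edges_D_def)
  show ?thesis
    using ramsey_number_tree_wheel8[OF check_ramsey_cert_D check_degree_cert_D sub _ symp_K6_bowtie]
      no_tree K6_bowtie_no_wheel
    by (simp add: tree_D_def edges_D_def)
qed

lemma ramsey_number_E: "ramsey_number tree_E (wheel 8) = 15"
proof -
  have sub: "set edges_E \<subseteq> {1..7} \<times> {1..7}"
    by (simp add: edges_E_def)
  have no_tree: "\<not> contains_subgraph (graph_on 14 K6_K44) (graph_of {1..7} (set edges_E))"
    using K6_K44_no_tree_E by (simp add: edges_E_def)
  show ?thesis
    using ramsey_number_tree_wheel8[OF check_ramsey_cert_E check_degree_cert_E sub _ symp_K6_K44]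
      no_tree K6_K44_no_wheel
    by (simp add: tree_E_def edges_E_def)
qed

theorem theorem5:
  shows "(\<forall>T \<in> {tree_A, tree_B, tree_C}. ramsey_number T (wheel 8) = 13)
    \<and> ramsey_number tree_D (wheel 8) = 14
    \<and> ramsey_number tree_E (wheel 8) = 15"
  by (simp add: ramsey_number_A ramsey_number_B ramsey_number_C ramsey_number_D ramsey_number_E)

end
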